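(* Let $G=\mathbf{CK}+\mathcal{C}$ be either a $T$-free or a $T$-full sequent calculus over $\mathcal{L}$, where $\mathcal{C}$ is a finite set of constructive formulas. Then $G$ has the feasible Visser–Harrop property.
   Context: Formulas of $\mathcal{L}$: atoms, $\top,\bot$, $\wedge,\vee,\to,\Box,\Diamond$. Sequents $\Sigma\Rightarrow\Lambda$ (finite multisets), rules (meta-sequents with schematic atoms and multiset variables, instantiated by formulas and multisets), calculi (finite sets of rules), $G+\mathcal{C}$ (adding axioms $\Rightarrow C$ for $C\in\mathcal{C}$), and tree-like $G$-proofs are as usual. A rule is feasibly provable in $G$ if a polynomial-time algorithm produces, for any instance, a $G$-proof of its conclusion from its premises. $\mathbf{LJ}$: single-conclusion calculus with $\Gamma,p\Rightarrow p$; $\Gamma,\bot\Rightarrow\Delta$; $\Gamma\Rightarrow\top$; left/right weakening; left contraction; cut $\frac{\Gamma\Rightarrow p\ \ \Gamma,p\Rightarrow\Delta}{\Gamma\Rightarrow\Delta}$; standard single-conclusion left/right rules for $\wedge,\vee,\to$. $\mathbf{CK}=\mathbf{LJ}+\{(K_\Box)\ \frac{\Gamma\Rightarrow p}{\Box\Gamma\Rightarrow\Box p},(K_\Diamond)\ \frac{\Gamma,p\Rightarrow q}{\Box\Gamma,\Diamond p\Rightarrow\Diamond q}\}$. $G$ is strong (over $\mathcal{L}$) if every axiom and rule of $\mathbf{CK}$ is feasibly provable in $G$. Basic formulas: smallest set containing atoms, $\top,\bot$, closed under $\wedge,\vee,\Diamond$. Almost positive: smallest set containing basic formulas, closed under $\wedge,\vee,\Box,\Diamond$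 and $A\to B$ with $A$ basic, $B$ almost positive. Constructive: smallest set containing basic formulas, closed under $\wedge,\Box$ and $A\to B$ with $A$ almost positive, $B$ constructive. One-node frames: under a valuation (set of true atoms), truth at the single node is classical for $\top,\bot,\wedge,\vee,\to$; in the reflexive node frame $\mathcal{K}_r$, $\Box\varphi,\Diamond\varphi$ are true iff $\varphi$ is; in the irreflexive node frame $\mathcal{K}_i$, $\Box\varphi$ is always true and $\Diamond\varphi$ always false. A sequent is valid in a frame if its formula $\bigwedge\Sigma\to\bigvee\Lambda$ is true under all valuations; a calculus is valid in a frame if all its provable sequents are. $G$ over $\mathcal{L}$ is $T$-free if strong and valid in $\mathcal{K}_i$; $T$-full if strong, valid in $\mathcal{K}_r$, and proving both $\Rightarrow\Box p\to p$ and $\Rightarrow p\to\Diamond p$. Harrop formulas: smallest set containing atoms, $\top,\bot$, closed under $\wedge$, $\Box$, and $A\to B$ with $A$ arbitrary and $B$ Harrop. $G$ has the feasible Visser–Harrop property if there is a polynomial-time function $f$ which reads any $G$-proof $\pi$ of a sequent $\Gamma,\{A_i\to B_i\}_{i\in I}\Rightarrow C\vee D$, with $\Gamma$ a finite multiset of Harrop formulas and $I$ a finite (possibly empty) index set, and outputs a $G$-proof of one of $\Gamma,\{A_i\to B_i\}_{i\in I}\Rightarrow C$, or $\Gamma,\{A_i\to B_i\}_{i\in I}\Rightarrow D$, or $\Gamma,\{A_i\to B_i\}_{i\in I}\Rightarrow A_i$ for some $i\in I$. *)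

theory Defs
  imports "HOL-Library.Multiset" "HOL-Computational_Algebra.Polynomial"
begin

section \<open>Formulas\<close>

datatype fm =
    Atom nat | Top | Bot
  | And fm fm | Or fm fm | Imp fm fm
  | Box fm | Dia fm

primrec fm_subst :: "(nat \<Rightarrow> fm) \<Rightarrow> fm \<Rightarrow> fm" where
  "fm_subst \<sigma> (Atom n) = \<sigma> n"
| "fm_subst \<sigma> Top = Top"
| "fm_subst \<sigma> Bot = Bot"
| "fm_subst \<sigma> (And A B) = And (fm_subst \<sigma> A) (fm_subst \<sigma> B)"
| "fm_subst \<sigma> (Or A B) = Or (fm_subst \<sigma> A) (fm_subst \<sigma> B)"
| "fm_subst \<sigma> (Imp A B) = Imp (fm_subst \<sigma> A) (fm_subst \<sigma> B)"
| "fm_subst \<sigma> (Box A) = Box (fm_subst \<sigma> A)"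
| "fm_subst \<sigma> (Dia A) = Dia (fm_subst \<sigma> A)"

inductive basic :: "fm \<Rightarrow> bool" where
  "basic (Atom n)"
| "basic Top"
| "basic Bot"
| "basic A \<Longrightarrow> basic B \<Longrightarrow> basic (And A B)"
| "basic A \<Longrightarrow> basic B \<Longrightarrow> basic (Or A B)"
| "basic A \<Longrightarrow> basic (Dia A)"

inductive almost_positive :: "fm \<Rightarrow> bool" where
  "basic A \<Longrightarrow> almost_positive A"
| "almost_positive A \<Longrightarrow> almost_positive B \<Longrightarrow> almost_positive (And A B)"
| "almost_positive A \<Longrightarrow> almost_positive B \<Longrightarrow> almost_positive (Or A B)"
| "almost_positive A \<Longrightarrow> almost_positive (Box A)"
| "almost_positive A \<Longrightarrow> almost_positive (Dia A)"
| "basic A \<Longrightarrow> almost_positive B \<Longrightarrow> almost_positive (Imp A B)"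

inductive constructive :: "fm \<Rightarrow> bool" where
  "basic A \<Longrightarrow> constructive A"
| "constructive A \<Longrightarrow> constructive B \<Longrightarrow> constructive (And A B)"
| "constructive A \<Longrightarrow> constructive (Box A)"
| "almost_positive A \<Longrightarrow> constructive B \<Longrightarrow> constructive (Imp A B)"

inductive harrop :: "fm \<Rightarrow> bool" where
  "harrop (Atom n)"
| "harrop Top"
| "harrop Bot"
| "harrop A \<Longrightarrow> harrop B \<Longrightarrow> harrop (And A B)"
| "harrop A \<Longrightarrow> harrop (Box A)"
| "harrop B \<Longrightarrow> harrop (Imp A B)"

section \<open>Sequents, rules and calculi\<close>

type_synonym sequent = "fm multiset \<times> fm multiset"

text \<open>An item of a meta-sequent is a multiset variable \<open>\<Gamma>\<^sub>i\<close>, a boxed multiset variable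
  \<open>\<box>\<Gamma>\<^sub>i\<close>, or a formula, whose atoms are schematic.\<close>

datatype item = MVar nat | BoxMVar nat | Fm fm

type_synonym meta_sequent = "item list \<times> item list"
type_synonym rule = "meta_sequent list \<times> meta_sequent"
type_synonym calculus = "rule set"

primrec inst_item :: "(nat \<Rightarrow> fm) \<Rightarrow> (nat \<Rightarrow> fm multiset) \<Rightarrow> item \<Rightarrow> fm multiset" where
  "inst_item \<sigma> \<tau> (MVar i) = \<tau> i"
| "inst_item \<sigma> \<tau> (BoxMVar i) = image_mset Box (\<tau> i)"
| "inst_item \<sigma> \<tau> (Fm A) = {#fm_subst \<sigma> A#}"

definition inst :: "(nat \<Rightarrow> fm) \<Rightarrow> (nat \<Rightarrow> fm multiset) \<Rightarrow> meta_sequent \<Rightarrow> sequent" where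
  "inst \<sigma> \<tau> S =
     (sum_list (map (inst_item \<sigma> \<tau>) (fst S)), sum_list (map (inst_item \<sigma> \<tau>) (snd S)))"

definition single_conclusion :: "sequent \<Rightarrow> bool" where
  "single_conclusion S \<longleftrightarrow> size (snd S) \<le> 1"

text \<open>All calculi considered are single-conclusion: an instantiation is admitted only if
  every resulting sequent has at most one formula in its succedent.\<close>

definition rule_instances :: "rule \<Rightarrow> (sequent list \<times> sequent) set" where
  "rule_instances r =
     {(map (inst \<sigma> \<tau>) (fst r), inst \<sigma> \<tau> (snd r)) | \<sigma> \<tau>.
        \<forall>S \<in> set (snd r # fst r). single_conclusion (inst \<sigma> \<tau> S)}"

datatype 's ptree = Node (root_label: 's) (subtrees: "'s ptree list")

inductive proof_from :: "calculus \<Rightarrow> sequent set \<Rightarrow> sequent ptree \<Rightarrow> bool"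
  for G :: calculus and H :: "sequent set" where
  assumption: "S \<in> H \<Longrightarrow> proof_from G H (Node S [])"
| inference: "r \<in> G \<Longrightarrow> (map root_label ts, S) \<in> rule_instances r \<Longrightarrow>
    (\<And>t. t \<in> set ts \<Longrightarrow> proof_from G H t) \<Longrightarrow> proof_from G H (Node S ts)"

definition provable :: "calculus \<Rightarrow> sequent \<Rightarrow> bool" where
  "provable G S \<longleftrightarrow> (\<exists>\<pi>. proof_from G {} \<pi> \<and> root_label \<pi> = S)"

definition LJ :: calculus where
  "LJ =
    (let \<Gamma> = MVar 0; \<Delta> = MVar 1; p = Atom 0; q = Atom 1 in
     { \<comment> \<open>axioms\<close>
       ([], ([\<Gamma>, Fm p], [Fm p])),
       ([], ([\<Gamma>, Fm Bot], [\<Delta>])),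
       ([], ([\<Gamma>], [Fm Top])),
       \<comment> \<open>left and right weakening, left contraction, cut\<close>
       ([([\<Gamma>], [\<Delta>])], ([\<Gamma>, Fm p], [\<Delta>])),
       ([([\<Gamma>], [])], ([\<Gamma>], [Fm p])),
       ([([\<Gamma>, Fm p, Fm p], [\<Delta>])], ([\<Gamma>, Fm p], [\<Delta>])),
       ([([\<Gamma>], [Fm p]), ([\<Gamma>, Fm p], [\<Delta>])], ([\<Gamma>], [\<Delta>])),
       \<comment> \<open>conjunction\<close>
       ([([\<Gamma>, Fm p], [\<Delta>])], ([\<Gamma>, Fm (And p q)], [\<Delta>])),
       ([([\<Gamma>, Fm q], [\<Delta>])], ([\<Gamma>, Fm (And p q)], [\<Delta>])),
       ([([\<Gamma>], [Fm p]), ([\<Gamma>], [Fm q])], ([\<Gamma>], [Fm (And p q)])),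
       \<comment> \<open>disjunction\<close>
       ([([\<Gamma>, Fm p], [\<Delta>]), ([\<Gamma>, Fm q], [\<Delta>])], ([\<Gamma>, Fm (Or p q)], [\<Delta>])),
       ([([\<Gamma>], [Fm p])], ([\<Gamma>], [Fm (Or p q)])),
       ([([\<Gamma>], [Fm q])], ([\<Gamma>], [Fm (Or p q)])),
       \<comment> \<open>implication\<close>
       ([([\<Gamma>], [Fm p]), ([\<Gamma>, Fm q], [\<Delta>])], ([\<Gamma>, Fm (Imp p q)], [\<Delta>])),
       ([([\<Gamma>, Fm p], [Fm q])], ([\<Gamma>], [Fm (Imp p q)])) })"

definition CK :: calculus where
  "CK = LJ \<union>
    (let \<Gamma> = MVar 0; \<Gamma>\<^sub>b = BoxMVar 0; p = Atom 0; q = Atom 1 in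
     { ([([\<Gamma>], [Fm p])], ([\<Gamma>\<^sub>b], [Fm (Box p)])),
       ([([\<Gamma>, Fm p], [Fm q])], ([\<Gamma>\<^sub>b, Fm (Dia p)], [Fm (Dia q)])) })"

definition add_axioms :: "calculus \<Rightarrow> fm set \<Rightarrow> calculus" where
  "add_axioms G \<C> = G \<union> {([], ([], [Fm C])) | C. C \<in> \<C>}"

section \<open>One-node frames\<close>

datatype frame = Reflexive_node | Irreflexive_node

primrec holds :: "frame \<Rightarrow> nat set \<Rightarrow> fm \<Rightarrow> bool" where
  "holds K V (Atom n) \<longleftrightarrow> n \<in> V"
| "holds K V Top \<longleftrightarrow> True"
| "holds K V Bot \<longleftrightarrow> False"
| "holds K V (And A B) \<longleftrightarrow> holds K V A \<and> holds K V B"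
| "holds K V (Or A B) \<longleftrightarrow> holds K V A \<or> holds K V B"
| "holds K V (Imp A B) \<longleftrightarrow> (holds K V A \<longrightarrow> holds K V B)"
| "holds K V (Box A) \<longleftrightarrow>
     (case K of Reflexive_node \<Rightarrow> holds K V A | Irreflexive_node \<Rightarrow> True)"
| "holds K V (Dia A) \<longleftrightarrow>
     (case K of Reflexive_node \<Rightarrow> holds K V A | Irreflexive_node \<Rightarrow> False)"

primrec big_and :: "fm list \<Rightarrow> fm" where
  "big_and [] = Top"
| "big_and (A # As) = And A (big_and As)"

primrec big_or :: "fm list \<Rightarrow> fm" where
  "big_or [] = Bot"
| "big_or (A # As) = Or A (big_or As)"

text \<open>The formula of a sequent depends on an enumeration of its two multisets; its truth
  value does not, so we quantify over all enumerations.\<close>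

definition valid_sequent :: "frame \<Rightarrow> sequent \<Rightarrow> bool" where
  "valid_sequent K S \<longleftrightarrow>
     (\<forall>As Bs V. mset As = fst S \<longrightarrow> mset Bs = snd S \<longrightarrow> holds K V (Imp (big_and As) (big_or Bs)))"

definition valid_calculus :: "frame \<Rightarrow> calculus \<Rightarrow> bool" where
  "valid_calculus K G \<longleftrightarrow> (\<forall>S. provable G S \<longrightarrow> valid_sequent K S)"

section \<open>Polynomial time\<close>

text \<open>The machine model is a first-order functional language with general recursion over
  binary trees. A program is a list of function bodies, and \<open>ECall f es\<close> runs the \<open>f\<close>-th
  body in the environment formed by its arguments; \<open>ECase e e\<^sub>1 e\<^sub>2\<close> branches on the value of
  \<open>e\<close> and binds the two components of a pair as variables 0 and 1 of \<open>e\<^sub>2\<close>.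

  Reading a variable or building a tree is charged with the full size of the resulting
  tree. So every value computed in a run has size at most the cost of the run, and costs
  agree with running times on Turing machines up to a polynomial; in particular, trees with
  shared subtrees are not counted as small.\<close>

datatype data = DNil | DPair data data

datatype expr = EVar nat | ENil | ECons expr expr | ECase expr expr expr | ECall nat "expr list"

inductive eval :: "expr list \<Rightarrow> data list \<Rightarrow> expr \<Rightarrow> data \<Rightarrow> nat \<Rightarrow> bool"
  and evals :: "expr list \<Rightarrow> data list \<Rightarrow> expr list \<Rightarrow> data list \<Rightarrow> nat \<Rightarrow> bool"
  for P :: "expr list" where
  eval_Var: "i < length \<rho> \<Longrightarrow> eval P \<rho> (EVar i) (\<rho> ! i) (1 + size (\<rho> ! i))"
| eval_Null: "eval P \<rho> ENil DNil 1"
| eval_Cons: "eval P \<rho> e1 v1 t1 \<Longrightarrow> eval P \<rho> e2 v2 t2 \<Longrightarrow>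
    eval P \<rho> (ECons e1 e2) (DPair v1 v2) (t1 + t2 + 1 + size (DPair v1 v2))"
| eval_Case_Nil: "eval P \<rho> e DNil t \<Longrightarrow> eval P \<rho> e1 v t1 \<Longrightarrow>
    eval P \<rho> (ECase e e1 e2) v (t + t1 + 1)"
| eval_Case_Pair: "eval P \<rho> e (DPair a b) t \<Longrightarrow> eval P (a # b # \<rho>) e2 v t2 \<Longrightarrow>
    eval P \<rho> (ECase e e1 e2) v (t + t2 + 1)"
| eval_Call: "f < length P \<Longrightarrow> evals P \<rho> es vs t \<Longrightarrow> eval P vs (P ! f) v t' \<Longrightarrow>
    eval P \<rho> (ECall f es) v (t + t' + 1)"
| evals_Nil: "evals P \<rho> [] [] 0"
| evals_Cons: "eval P \<rho> e v t \<Longrightarrow> evals P \<rho> es vs t' \<Longrightarrow>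
    evals P \<rho> (e # es) (v # vs) (t + t')"

definition poly_time :: "('a \<Rightarrow> data) \<Rightarrow> ('b \<Rightarrow> data) \<Rightarrow> ('a \<Rightarrow> 'b) \<Rightarrow> bool" where
  "poly_time enc_in enc_out f \<longleftrightarrow>
     (\<exists>P e. \<exists>q :: nat poly. \<forall>x. \<exists>t \<le> poly q (size (enc_in x)).
        eval P [enc_in x] e (enc_out (f x)) t)"

section \<open>Encodings\<close>

text \<open>An algorithm reads multisets in some order: it works on written sequents, whose two
  sides are lists. Trees of written sequents present trees of sequents.\<close>

type_synonym wsequent = "fm list \<times> fm list"

definition sequent_of :: "wsequent \<Rightarrow> sequent" where
  "sequent_of S = (mset (fst S), mset (snd S))"

definition written_proof ::
    "calculus \<Rightarrow> sequent set \<Rightarrow> sequent \<Rightarrow> wsequent ptree \<Rightarrow> bool" where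
  "written_proof G H S \<pi> \<longleftrightarrow>
     proof_from G H (map_ptree sequent_of \<pi>) \<and> root_label (map_ptree sequent_of \<pi>) = S"

primrec enc_list :: "data list \<Rightarrow> data" where
  "enc_list [] = DNil"
| "enc_list (d # ds) = DPair d (enc_list ds)"

text \<open>Binary, least significant digit first.\<close>

fun enc_nat :: "nat \<Rightarrow> data" where
  "enc_nat n =
     (if n = 0 then DNil
      else DPair (if even n then DNil else DPair DNil DNil) (enc_nat (n div 2)))"

declare enc_nat.simps [simp del]

primrec enc_fm :: "fm \<Rightarrow> data" where
  "enc_fm (Atom n) = DPair (enc_nat 0) (enc_nat n)"
| "enc_fm Top = DPair (enc_nat 1) DNil"
| "enc_fm Bot = DPair (enc_nat 2) DNil"
| "enc_fm (And A B) = DPair (enc_nat 3) (DPair (enc_fm A) (enc_fm B))"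
| "enc_fm (Or A B) = DPair (enc_nat 4) (DPair (enc_fm A) (enc_fm B))"
| "enc_fm (Imp A B) = DPair (enc_nat 5) (DPair (enc_fm A) (enc_fm B))"
| "enc_fm (Box A) = DPair (enc_nat 6) (enc_fm A)"
| "enc_fm (Dia A) = DPair (enc_nat 7) (enc_fm A)"

definition enc_wsequent :: "wsequent \<Rightarrow> data" where
  "enc_wsequent S = DPair (enc_list (map enc_fm (fst S))) (enc_list (map enc_fm (snd S)))"

primrec enc_ptree :: "wsequent ptree \<Rightarrow> data" where
  "enc_ptree (Node S ts) = DPair (enc_wsequent S) (enc_list (map enc_ptree ts))"

definition enc_inference :: "wsequent list \<times> wsequent \<Rightarrow> data" where
  "enc_inference x = DPair (enc_list (map enc_wsequent (fst x))) (enc_wsequent (snd x))"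

section \<open>Feasible notions\<close>

definition feasibly_provable :: "calculus \<Rightarrow> rule \<Rightarrow> bool" where
  "feasibly_provable G r \<longleftrightarrow>
     (\<exists>f. poly_time enc_inference enc_ptree f \<and>
        (\<forall>Ss S. (map sequent_of Ss, sequent_of S) \<in> rule_instances r \<longrightarrow>
           written_proof G (set (map sequent_of Ss)) (sequent_of S) (f (Ss, S))))"

definition strong :: "calculus \<Rightarrow> bool" where
  "strong G \<longleftrightarrow> (\<forall>r \<in> CK. feasibly_provable G r)"

definition T_free :: "calculus \<Rightarrow> bool" where
  "T_free G \<longleftrightarrow> strong G \<and> valid_calculus Irreflexive_node G"

definition T_full :: "calculus \<Rightarrow> bool" where
  "T_full G \<longleftrightarrow> strong G \<and> valid_calculus Reflexive_node G \<and>
     (\<forall>n. provable G ({#}, {#Imp (Box (Atom n)) (Atom n)#})) \<and>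
     (\<forall>n. provable G ({#}, {#Imp (Atom n) (Dia (Atom n))#}))"

text \<open>The function reads only the proof. The splitting of the antecedent into Harrop
  formulas and implications is not part of its input, and the output has to be correct
  for every such splitting.\<close>

definition feasible_Visser_Harrop :: "calculus \<Rightarrow> bool" where
  "feasible_Visser_Harrop G \<longleftrightarrow>
     (\<exists>f. poly_time enc_ptree enc_ptree f \<and>
        (\<forall>\<pi> \<Gamma> (I :: nat set) A B C D \<Sigma>.
           (\<forall>H \<in># \<Gamma>. harrop H) \<longrightarrow> finite I \<longrightarrow>
           \<Sigma> = \<Gamma> + image_mset (\<lambda>i. Imp (A i) (B i)) (mset_set I) \<longrightarrow>
           written_proof G {} (\<Sigma>, {#Or C D#}) \<pi> \<longrightarrow>
             written_proof G {} (\<Sigma>, {#C#}) (f \<pi>) \<or>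
             written_proof G {} (\<Sigma>, {#D#}) (f \<pi>) \<or>
             (\<exists>i \<in> I. written_proof G {} (\<Sigma>, {#A i#}) (f \<pi>))))"

end

theory Submission
  imports Defs
begin

text \<open>
  Unit resolution on the sequents of a proof \<open>\<pi>\<close> of \<open>\<Sigma> \<Rightarrow> C \<or> D\<close>. Read every sequent \<open>\<Gamma> \<Rightarrow> F\<close> of \<open>\<pi>\<close>,
  together with a few provable Horn sequents such as \<open>A, B \<Rightarrow> A \<and> B\<close> and \<open>A \<rightarrow> B, A \<Rightarrow> B\<close> for all
  subformulas \<open>A\<close>, \<open>B\<close> of \<open>\<pi>\<close>, as a clause that marks \<open>F\<close> once all of \<open>\<Gamma>\<close> is marked, and mark formulas
  starting from \<open>\<Sigma>\<close>. Marked formulas have proofs from \<open>\<Sigma>\<close>: a linear chain of cuts on the formulas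
  marked so far, which stays of polynomial size although proofs are trees. Let \<open>M\<close> be the set of
  marked formulas. If none of \<open>C\<close>, \<open>D\<close> and the antecedents \<open>A\<^sub>i\<close> were in \<open>M\<close>, then all of \<open>\<Sigma>\<close>
  would be true under Aczel's slash with \<open>M\<close> in place of provability, and the slash is preserved by
  the rules used in \<open>\<pi>\<close>; so \<open>C\<close> or \<open>D\<close> would be slashed and hence marked, a contradiction. An axiom
  instance \<open>\<sigma>(C)\<close> with \<open>C\<close> constructive is slashed because \<open>C\<close> is true at the one-node frame under
  the valuation that makes an atom \<open>p\<close> true iff \<open>\<sigma>(p)\<close> is slashed.
\<close>

section \<open>Polynomially bounded running times\<close>

text \<open>Powers of \<open>n + 2\<close> serve as bounds because the base is at least 2 even at
  \<open>n = 0\<close>, so constants and numerical factors can be absorbed into the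
  exponent.\<close>

definition poly_bounded :: "(nat \<Rightarrow> nat) \<Rightarrow> bool" where
  "poly_bounded f \<longleftrightarrow> (\<exists>k. \<forall>n. f n \<le> (n + 2) ^ k)"

lemma poly_bounded_const: "poly_bounded (\<lambda>_. c)"
proof -
  have "c \<le> (n + 2) ^ c" for n :: nat
    using less_exp[of c] power_mono[of 2 "n + 2" c] by linarith
  then show ?thesis unfolding poly_bounded_def by blast
qed

lemma poly_bounded_id: "poly_bounded (\<lambda>n. n)"
  unfolding poly_bounded_def by (rule exI[of _ 1]) simp

lemma poly_bounded_add:
  assumes "poly_bounded f" "poly_bounded g" shows "poly_bounded (\<lambda>n. f n + g n)"
proof -
  obtain k l where kl: "\<And>n. f n \<le> (n + 2) ^ k" "\<And>n. g n \<le> (n + 2) ^ l"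
    using assms unfolding poly_bounded_def by blast
  have "f n + g n \<le> (n + 2) ^ (k + l + 1)" for n
  proof -
    have "(n + 2) ^ k \<le> (n + 2) ^ (k + l)" "(n + 2) ^ l \<le> (n + 2) ^ (k + l)"
      by (intro power_increasing; simp)+
    moreover have "2 * (n + 2) ^ (k + l) \<le> (n + 2) ^ (k + l + 1)" by simp
    ultimately show ?thesis using kl[of n] by linarith
  qed
  then show ?thesis unfolding poly_bounded_def by blast
qed

lemma poly_bounded_mult:
  assumes "poly_bounded f" "poly_bounded g" shows "poly_bounded (\<lambda>n. f n * g n)"
proof -
  obtain k l where kl: "\<And>n. f n \<le> (n + 2) ^ k" "\<And>n. g n \<le> (n + 2) ^ l"
    using assms unfolding poly_bounded_def by blast
  have "f n * g n \<le> (n + 2) ^ (k + l)" for n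
    using mult_le_mono[OF kl[of n]] by (simp add: power_add)
  then show ?thesis unfolding poly_bounded_def by blast
qed

lemma poly_bounded_comp:
  assumes "poly_bounded f" "poly_bounded g" shows "poly_bounded (\<lambda>n. f (g n))"
proof -
  obtain k l where kl: "\<And>n. f n \<le> (n + 2) ^ k" "\<And>n. g n \<le> (n + 2) ^ l"
    using assms unfolding poly_bounded_def by blast
  have "f (g n) \<le> (n + 2) ^ ((l + 2) * k)" for n
  proof -
    \<comment> \<open>Two extra factors \<open>n + 2\<close> contribute at least 4, which leaves
      room for both \<open>g n\<close> and the summand 2 below
      \<open>(n + 2) ^ (l + 2)\<close>.\<close>
    have "2 * 2 * 1 \<le> (n + 2) * (n + 2) * (n + 2) ^ l" by (intro mult_le_mono) auto
    moreover have "2 * 2 * (n + 2) ^ l \<le> (n + 2) * (n + 2) * (n + 2) ^ l"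
      by (intro mult_le_mono) auto
    moreover have "(n + 2) ^ (l + 2) = (n + 2) * (n + 2) * (n + 2) ^ l"
      by (simp only: power_add power2_eq_square ac_simps)
    ultimately have "g n + 2 \<le> (n + 2) ^ (l + 2)" using kl(2)[of n] by linarith
    then have "(g n + 2) ^ k \<le> ((n + 2) ^ (l + 2)) ^ k" by (intro power_mono) auto
    also have "\<dots> = (n + 2) ^ ((l + 2) * k)" by (simp only: power_mult)
    finally show ?thesis using kl(1)[of "g n"] by linarith
  qed
  then show ?thesis unfolding poly_bounded_def by blast
qed

lemmas poly_bounded_intros = poly_bounded_const poly_bounded_id poly_bounded_add poly_bounded_mult

text \<open>A monotone bound can be evaluated at an estimate for the size of an intermediate value
  in place of the size itself.\<close>

lemma poly_bounded_mono_bound: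
  assumes "poly_bounded f" obtains q where "poly_bounded q" "mono q" "\<And>n. f n \<le> q n"
proof -
  obtain k where k: "\<And>n. f n \<le> (n + 2) ^ k" using assms unfolding poly_bounded_def by blast
  show thesis
  proof (rule that[of "\<lambda>n. (n + 2) ^ k"])
    show "poly_bounded (\<lambda>n. (n + 2) ^ k)" unfolding poly_bounded_def by blast
    show "mono (\<lambda>n :: nat. (n + 2) ^ k)" by (intro monoI power_mono) auto
  qed (rule k)
qed

section \<open>Relocating programs\<close>

primrec shift :: "nat \<Rightarrow> expr \<Rightarrow> expr" where
  "shift k (EVar i) = EVar i"
| "shift k ENil = ENil"
| "shift k (ECons a b) = ECons (shift k a) (shift k b)"
| "shift k (ECase a b c) = ECase (shift k a) (shift k b) (shift k c)"
| "shift k (ECall f es) = ECall (k + f) (map (shift k) es)"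

lemma eval_append: "eval P \<rho> e v t \<Longrightarrow> eval (P @ Q) \<rho> e v t"
  and evals_append: "evals P \<rho> es vs t \<Longrightarrow> evals (P @ Q) \<rho> es vs t"
proof (induction rule: eval_evals.inducts)
  case (eval_Call f \<rho> es vs t v t')
  then show ?case using eval_evals.eval_Call[of f "P @ Q"] by (simp add: nth_append)
qed (auto intro: eval_evals.intros simp del: One_nat_def data.size add_Suc_right)

text \<open>Behind \<open>P\<close> every body of \<open>Q\<close> has moved by
  \<open>length P\<close>, and \<open>shift\<close> moves the call indices by the same amount.
  Variables refer to the environment, so neither value nor cost changes.\<close>

lemma eval_shift: "eval Q \<rho> e v t \<Longrightarrow> eval (P @ map (shift (length P)) Q) \<rho> (shift (length P) e) v t"
  and evals_shift: "evals Q \<rho> es vs t \<Longrightarrow>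
    evals (P @ map (shift (length P)) Q) \<rho> (map (shift (length P)) es) vs t"
proof (induction rule: eval_evals.inducts)
  case (eval_Call f \<rho> es vs t v t')
  then show ?case
    using eval_evals.eval_Call[of "length P + f" "P @ map (shift (length P)) Q"]
    by (simp add: nth_append)
qed (auto intro: eval_evals.intros simp del: One_nat_def data.size add_Suc_right)

text \<open>Reading a variable and building a pair are charged the full size of the resulting tree;
  case distinctions and calls only pass on a value that has been paid for already.\<close>

lemma eval_size: "eval P \<rho> e v t \<Longrightarrow> size v \<le> t"
  and evals_size: "evals P \<rho> es vs t \<Longrightarrow> True"
  by (induction rule: eval_evals.inducts) auto

text \<open>An upper bound in place of the exact cost can be rounded up at every step.\<close>

definition eval_within :: "expr list \<Rightarrow> data list \<Rightarrow> expr \<Rightarrow> data \<Rightarrow> nat \<Rightarrow> bool" where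
  "eval_within P \<rho> e v m \<longleftrightarrow> (\<exists>t\<le>m. eval P \<rho> e v t)"

lemma eval_within_size: "eval_within P \<rho> e v m \<Longrightarrow> size v \<le> m"
  unfolding eval_within_def using eval_size by fastforce

lemma eval_within_le: "eval_within P \<rho> e v m \<Longrightarrow> m \<le> m' \<Longrightarrow> eval_within P \<rho> e v m'"
  unfolding eval_within_def by (meson order_trans)

lemma eval_within_Var: "i < length \<rho> \<Longrightarrow> \<rho> ! i = v \<Longrightarrow> eval_within P \<rho> (EVar i) v (1 + size v)"
  unfolding eval_within_def using eval_Var by blast

lemma eval_within_Nil: "eval_within P \<rho> ENil DNil 1"
  unfolding eval_within_def using eval_Null by blast

lemma eval_within_Cons:
  assumes "eval_within P \<rho> e1 v1 m1" "eval_within P \<rho> e2 v2 m2"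
  shows "eval_within P \<rho> (ECons e1 e2) (DPair v1 v2) (m1 + m2 + 2 + size v1 + size v2)"
proof -
  obtain t1 t2 where "t1 \<le> m1" "t2 \<le> m2" and e: "eval P \<rho> e1 v1 t1" "eval P \<rho> e2 v2 t2"
    using assms unfolding eval_within_def by blast
  then show ?thesis unfolding eval_within_def
    by (intro exI[of _ "t1 + t2 + 1 + size (DPair v1 v2)"] conjI eval_Cons) simp_all
qed

lemma eval_within_Case_Nil:
  assumes "eval_within P \<rho> e DNil m" "eval_within P \<rho> e1 v m1"
  shows "eval_within P \<rho> (ECase e e1 e2) v (m + m1 + 1)"
proof -
  obtain t t1 where "t \<le> m" "t1 \<le> m1" and e: "eval P \<rho> e DNil t" "eval P \<rho> e1 v t1"
    using assms unfolding eval_within_def by blast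
  then show ?thesis unfolding eval_within_def
    by (intro exI[of _ "t + t1 + 1"] conjI eval_Case_Nil) simp_all
qed

lemma eval_within_Case_Pair:
  assumes "eval_within P \<rho> e (DPair a b) m" "eval_within P (a # b # \<rho>) e2 v m2"
  shows "eval_within P \<rho> (ECase e e1 e2) v (m + m2 + 1)"
proof -
  obtain t t2 where "t \<le> m" "t2 \<le> m2"
    and e: "eval P \<rho> e (DPair a b) t" "eval P (a # b # \<rho>) e2 v t2"
    using assms unfolding eval_within_def by blast
  then show ?thesis unfolding eval_within_def
    by (intro exI[of _ "t + t2 + 1"] conjI eval_Case_Pair[where a = a and b = b]) simp_all
qed

lemma eval_within_Call1:
  assumes "f < length P" "eval_within P \<rho> e v m" "eval_within P [v] (P ! f) w m'"
  shows "eval_within P \<rho> (ECall f [e]) w (m + m' + 1)"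
proof -
  obtain t t' where "t \<le> m" "t' \<le> m'" and e: "eval P \<rho> e v t" "eval P [v] (P ! f) w t'"
    using assms unfolding eval_within_def by blast
  then show ?thesis unfolding eval_within_def
    using eval_Call[OF assms(1) evals_Cons[OF e(1) evals_Nil] e(2)]
    by (intro exI[of _ "(t + 0) + t' + 1"]) simp
qed

lemma eval_within_Call2:
  assumes "f < length P" "eval_within P \<rho> e1 v1 m1" "eval_within P \<rho> e2 v2 m2"
    "eval_within P [v1, v2] (P ! f) w m'"
  shows "eval_within P \<rho> (ECall f [e1, e2]) w (m1 + m2 + m' + 1)"
proof -
  obtain t1 t2 t' where "t1 \<le> m1" "t2 \<le> m2" "t' \<le> m'"
    and e: "eval P \<rho> e1 v1 t1" "eval P \<rho> e2 v2 t2" "eval P [v1, v2] (P ! f) w t'"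
    using assms unfolding eval_within_def by blast
  then show ?thesis unfolding eval_within_def
    using eval_Call[OF assms(1) evals_Cons[OF e(1) evals_Cons[OF e(2) evals_Nil]] e(3)]
    by (intro exI[of _ "(t1 + (t2 + 0)) + t' + 1"]) simp
qed

section \<open>Closure properties of polynomial time\<close>

definition ptime :: "(data \<Rightarrow> data) \<Rightarrow> bool" where
  "ptime F \<longleftrightarrow> (\<exists>P e q. poly_bounded q \<and> (\<forall>x. eval_within P [x] e (F x) (q (size x))))"

definition computes :: "expr list \<Rightarrow> nat \<Rightarrow> (nat \<Rightarrow> nat) \<Rightarrow> (data \<Rightarrow> data) \<Rightarrow> bool" where
  "computes P i q F \<longleftrightarrow> i < length P \<and> (\<forall>x. eval_within P [x] (P ! i) (F x) (q (size x)))"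

lemma computes_append: "computes P i q F \<Longrightarrow> computes (P @ Q) i q F"
  unfolding computes_def eval_within_def by (auto simp: nth_append) (meson eval_append)

lemma computes_shift:
  "computes Q i q F \<Longrightarrow> computes (P @ map (shift (length P)) Q) (length P + i) q F"
  unfolding computes_def eval_within_def by (auto simp: nth_append) (meson eval_shift)

lemma computes_le: "computes P i q F \<Longrightarrow> (\<And>n. q n \<le> q' n) \<Longrightarrow> computes P i q' F"
  unfolding computes_def using eval_within_le by blast

text \<open>The main expression becomes an additional last body, which other programs can reach by
  \<open>ECall\<close>.\<close>

lemma ptime_computes:
  assumes "ptime F" obtains P i q where "poly_bounded q" "computes P i q F"
proof -
  obtain P e q where q: "poly_bounded q" and e: "\<And>x. eval_within P [x] e (F x) (q (size x))"
    using assms unfolding ptime_def by blast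
  have "computes (P @ [e]) (length P) q F"
    using e unfolding computes_def eval_within_def by (auto simp: nth_append) (meson eval_append)
  then show thesis using that q by blast
qed

text \<open>This lemma links programs: finitely many polynomial-time functions get entry points in
  one program with a common monotone bound, so that a new expression may call all of them.\<close>

lemma ptime_common:
  assumes "\<forall>F \<in> set Fs. ptime F"
  obtains P q idx where "poly_bounded q" "mono q" "\<And>F. F \<in> set Fs \<Longrightarrow> computes P (idx F) q F"
  using assms
proof (induction Fs arbitrary: thesis)
  case Nil
  show ?case by (rule Nil(1)[of "\<lambda>_. 0"]) (auto intro: poly_bounded_const monoI)
next
  case (Cons F Fs)
  obtain P q idx where q: "poly_bounded q" "mono q" and P: "\<And>F. F \<in> set Fs \<Longrightarrow> computes P (idx F) q F"
    using Cons(1) Cons(3) by auto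
  obtain Q i r where r: "poly_bounded r" and Q: "computes Q i r F"
    by (rule ptime_computes[of F]) (use Cons(3) in auto)
  obtain s where s: "poly_bounded s" "mono s" and sb: "\<And>n. q n + r n \<le> s n"
    using poly_bounded_mono_bound[OF poly_bounded_add[OF q(1) r]] by blast
  let ?P = "Q @ map (shift (length Q)) P"
  have "computes ?P (if F' = F then i else length Q + idx F') s F'" if "F' \<in> set (F # Fs)" for F'
  proof (cases "F' = F")
    case True
    then show ?thesis using computes_le[OF computes_append[OF Q], of s] sb
      by (simp) (meson add_leD2)
  next
    case False
    then show ?thesis using computes_le[OF computes_shift[OF P], of F' s] that sb
      by simp (meson add_leD1)
  qed
  then show ?case
    by (rule Cons(2)[OF s, where idx = "\<lambda>F'. if F' = F then i else length Q + idx F'"])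
qed

lemma computes_Call:
  assumes "computes P i q F" "mono q" "eval_within P \<rho> e v m"
  shows "eval_within P \<rho> (ECall i [e]) (F v) (m + q (size v) + 1)"
  using assms eval_within_Call1 unfolding computes_def by blast

lemma ptime_id: "ptime (\<lambda>x. x)"
  unfolding ptime_def
  by (intro exI[of _ "[]"] exI[of _ "EVar 0"] exI[of _ "\<lambda>n. 1 + n"] conjI allI poly_bounded_intros eval_within_Var) auto

lemma ptime_const: "ptime (\<lambda>_. c)"
proof -
  have "\<exists>e m. \<forall>\<rho>. eval_within [] \<rho> e c m"
    by (induction c) (meson eval_within_Nil eval_within_Cons)+
  then show ?thesis unfolding ptime_def using poly_bounded_const by blast
qed

lemma ptime_size:
  assumes "ptime F" obtains q where "poly_bounded q" "mono q" "\<And>x. size (F x) \<le> q (size x)"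
proof -
  obtain P e q where q: "poly_bounded q" and e: "\<And>x. eval_within P [x] e (F x) (q (size x))"
    using assms unfolding ptime_def by blast
  obtain r where r: "poly_bounded r" "mono r" "\<And>n. q n \<le> r n" using poly_bounded_mono_bound[OF q] by blast
  show thesis by (rule that[OF r(1,2)]) (meson e eval_within_size order_trans r(3))
qed

lemma ptime_comp:
  assumes "ptime F" "ptime G" shows "ptime (\<lambda>x. F (G x))"
proof -
  obtain P q idx where q: "poly_bounded q" "mono q"
    and P: "\<And>H. H \<in> set [F, G] \<Longrightarrow> computes P (idx H) q H"
    by (rule ptime_common[of "[F, G]"]) (use assms in auto)
  have "eval_within P [x] (ECall (idx F) [ECall (idx G) [EVar 0]]) (F (G x))
      (3 + size x + q (size x) + q (q (size x)))" for x
  proof -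
    have G: "eval_within P [x] (ECall (idx G) [EVar 0]) (G x) (1 + size x + q (size x) + 1)"
      using computes_Call[OF P q(2) eval_within_Var, of G 0 "[x]" x] by simp
    have "size (G x) \<le> q (size x)"
      using P[of G] unfolding computes_def by (auto dest: eval_within_size)
    then have "q (size (G x)) \<le> q (q (size x))" using q(2) by (rule monoD[rotated])
    then show ?thesis
      by (intro eval_within_le[OF computes_Call[OF P q(2) G]]) auto
  qed
  moreover have "poly_bounded (\<lambda>n. 3 + n + q n + q (q n))"
    by (intro poly_bounded_intros q poly_bounded_comp[OF q(1) q(1)])
  ultimately show ?thesis unfolding ptime_def by blast
qed

lemma ptime_DPair:
  assumes "ptime F" "ptime G" shows "ptime (\<lambda>x. DPair (F x) (G x))"
proof -
  obtain P q idx where q: "poly_bounded q" "mono q"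
    and P: "\<And>H. H \<in> set [F, G] \<Longrightarrow> computes P (idx H) q H"
    by (rule ptime_common[of "[F, G]"]) (use assms in auto)
  have c: "eval_within P [x] (ECall (idx H) [EVar 0]) (H x) (1 + size x + q (size x) + 1)"
    and s: "size (H x) \<le> q (size x)" if "H \<in> set [F, G]" for H x
    using computes_Call[OF P q(2) eval_within_Var, of H 0 "[x]" x] P[of H] that
    unfolding computes_def by (auto dest: eval_within_size)
  have "eval_within P [x] (ECons (ECall (idx F) [EVar 0]) (ECall (idx G) [EVar 0])) (DPair (F x) (G x))
      (6 + 2 * size x + 4 * q (size x))" for x
    using s[of F x] s[of G x] by (intro eval_within_le[OF eval_within_Cons[OF c c]]) auto
  moreover have "poly_bounded (\<lambda>n. 6 + 2 * n + 4 * q n)" by (intro poly_bounded_intros q)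
  ultimately show ?thesis unfolding ptime_def by blast
qed

primrec dfst where "dfst DNil = DNil" | "dfst (DPair a b) = a"
primrec dsnd where "dsnd DNil = DNil" | "dsnd (DPair a b) = b"

lemma ptime_dfst_base: "ptime dfst"
proof -
  have "eval_within [] [x] (ECase (EVar 0) ENil (EVar 0)) (dfst x) (size x + size x + 6)" for x
  proof (cases x)
    case DNil
    then show ?thesis
      using eval_within_le[OF eval_within_Case_Nil[OF eval_within_Var[of 0 "[x]" DNil] eval_within_Nil]] by simp
  next
    case (DPair a b)
    then show ?thesis
      using eval_within_le[OF eval_within_Case_Pair[OF eval_within_Var[of 0 "[x]" "DPair a b"]
            eval_within_Var[of 0 "[a, b, x]" a]]] by simp
  qed
  moreover have "poly_bounded (\<lambda>n. n + n + 6)" by (intro poly_bounded_intros)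
  ultimately show ?thesis unfolding ptime_def by blast
qed

lemma ptime_dsnd_base: "ptime dsnd"
proof -
  have "eval_within [] [x] (ECase (EVar 0) ENil (EVar 1)) (dsnd x) (size x + size x + 6)" for x
  proof (cases x)
    case DNil
    then show ?thesis
      using eval_within_le[OF eval_within_Case_Nil[OF eval_within_Var[of 0 "[x]" DNil] eval_within_Nil]] by simp
  next
    case (DPair a b)
    then show ?thesis
      using eval_within_le[OF eval_within_Case_Pair[OF eval_within_Var[of 0 "[x]" "DPair a b"]
            eval_within_Var[of 1 "[a, b, x]" b]]] by simp
  qed
  moreover have "poly_bounded (\<lambda>n. n + n + 6)" by (intro poly_bounded_intros)
  ultimately show ?thesis unfolding ptime_def by blast
qed

lemmas ptime_dfst = ptime_comp[OF ptime_dfst_base] and ptime_dsnd = ptime_comp[OF ptime_dsnd_base]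

lemma ptime_if_Nil:
  assumes "ptime F" "ptime G" "ptime H"
  shows "ptime (\<lambda>x. if F x = DNil then G x else H x)"
proof -
  obtain P q idx where q: "poly_bounded q" "mono q"
    and P: "\<And>K. K \<in> set [F, G, H] \<Longrightarrow> computes P (idx K) q K"
    by (rule ptime_common[of "[F, G, H]"]) (use assms in auto)
  have c: "eval_within P \<rho> (ECall (idx K) [EVar i]) (K x) (1 + size x + q (size x) + 1)"
    if "K \<in> set [F, G, H]" "i < length \<rho>" "\<rho> ! i = x" for K x i \<rho>
    using computes_Call[OF P q(2) eval_within_Var, of K i \<rho> x] that by auto
  \<comment> \<open>In the pair branch \<open>ECase\<close> has put the two components in front of
    the environment, so the input has moved from position 0 to position 2.\<close>
  have "eval_within P [x] (ECase (ECall (idx F) [EVar 0]) (ECall (idx G) [EVar 0]) (ECall (idx H) [EVar 2]))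
      (if F x = DNil then G x else H x) (5 + 2 * size x + 2 * q (size x))" for x
  proof (cases "F x")
    case DNil
    then show ?thesis
      using eval_within_le[OF eval_within_Case_Nil[OF _ c[of G 0 "[x]" x]]] c[of F 0 "[x]" x] by simp
  next
    case (DPair a b)
    then show ?thesis
      using eval_within_le[OF eval_within_Case_Pair[OF _ c[of H 2 "[a, b, x]" x]]] c[of F 0 "[x]" x] by simp
  qed
  moreover have "poly_bounded (\<lambda>n. 5 + 2 * n + 2 * q n)" by (intro poly_bounded_intros q)
  ultimately show ?thesis unfolding ptime_def by blast
qed

section \<open>The cost of tree recursion with a parameter\<close>

primrec drec ::
  "(data \<Rightarrow> data) \<Rightarrow> (data \<Rightarrow> data \<Rightarrow> data \<Rightarrow> data \<Rightarrow> data \<Rightarrow> data) \<Rightarrow>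
   (data \<Rightarrow> data \<Rightarrow> data \<Rightarrow> data) \<Rightarrow> (data \<Rightarrow> data \<Rightarrow> data \<Rightarrow> data) \<Rightarrow> data \<Rightarrow> data \<Rightarrow> data" where
  "drec z g l r DNil p = z p"
| "drec z g l r (DPair a b) p = g a b p (drec z g l r a (l a b p)) (drec z g l r b (r a b p))"

text \<open>The recursion visits each of the \<open>2 * size x + 1\<close> nodes of \<open>x\<close>
  once. By \<open>sl\<close> and \<open>sr\<close> the subtree and the parameter together never
  outgrow their initial size, and \<open>w\<close> bounds the results, so each visit costs a
  polynomial amount. Arguments are packed into nested pairs because \<open>ptime\<close> concerns
  unary functions.\<close>

lemma ptime_drec_base:
  assumes Z: "ptime z"
    and G: "ptime (\<lambda>y. g (dfst y) (dfst (dsnd y)) (dfst (dsnd (dsnd y)))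
                  (dfst (dsnd (dsnd (dsnd y)))) (dsnd (dsnd (dsnd (dsnd y)))))" (is "ptime ?g")
    and L: "ptime (\<lambda>y. l (dfst y) (dfst (dsnd y)) (dsnd (dsnd y)))" (is "ptime ?l")
    and R: "ptime (\<lambda>y. r (dfst y) (dfst (dsnd y)) (dsnd (dsnd y)))" (is "ptime ?r")
    and U: "ptime u" and V: "ptime v"
    and sl: "\<And>a b p. size (l a b p) \<le> size b + size p + 1"
    and sr: "\<And>a b p. size (r a b p) \<le> size a + size p + 1"
    and bnd: "poly_bounded w" "mono w" "\<And>x p. size (drec z g l r x p) \<le> w (size x + size p)"
  shows "ptime (\<lambda>x. drec z g l r (u x) (v x))"
proof -
  obtain P q idx where q: "poly_bounded q" "mono q"
    and P: "\<And>H. H \<in> set [z, ?g, ?l, ?r, u, v] \<Longrightarrow> computes P (idx H) q H"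
    by (rule ptime_common[of "[z, ?g, ?l, ?r, u, v]"]) (use Z G L R U V in auto)
  define f where "f = length P"
  \<comment> \<open>The body will be appended at index \<open>f\<close>, so \<open>ECall f\<close>
    is the recursive call. In the pair branch the environment is \<open>[a, b, x, p]\<close>, and
    the parameter is \<open>EVar 3\<close>.\<close>
  define body where "body = ECase (EVar 0) (ECall (idx z) [EVar 1])
    (ECall (idx ?g) [ECons (EVar 0) (ECons (EVar 1) (ECons (EVar 3) (ECons
       (ECall f [EVar 0, ECall (idx ?l) [ECons (EVar 0) (ECons (EVar 1) (EVar 3))]])
       (ECall f [EVar 1, ECall (idx ?r) [ECons (EVar 0) (ECons (EVar 1) (EVar 3))]]))))])"
  define P' where "P' = P @ [body]"
  have f: "f < length P'" "P' ! f = body" unfolding P'_def f_def by auto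
  have P': "computes P' (idx H) q H" if "H \<in> set [z, ?g, ?l, ?r, u, v]" for H
    unfolding P'_def using computes_append[OF P[OF that]] .
  \<comment> \<open>\<open>B n\<close> bounds the work at one node apart from the recursive calls,
    when subtree and parameter have total size at most \<open>n\<close>: two calls that compute the
    new parameters, and one call of \<open>g\<close> whose arguments include two results of size at
    most \<open>w n\<close>.\<close>
  define B where "B n = 100 * n + 10 * w n + 100 + 2 * q (10 * n + 10) + q (10 * n + 10 + 2 * w n)" for n
  have main: "eval_within P' [x, p] body (drec z g l r x p) ((2 * size x + 1) * B n)"
    if "size x + size p \<le> n" for x p n using that
  proof (induction x arbitrary: p)
    case DNil
    have "eval_within P' [DNil, p] (ECall (idx z) [EVar 1]) (z p) (1 + size p + q (size p) + 1)"
      using computes_Call[OF P' q(2) eval_within_Var, of z 1 "[DNil, p]" p] by simp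
    from eval_within_Case_Nil[OF eval_within_Var[of 0 "[DNil, p]" DNil] this]
    have "eval_within P' [DNil, p] body (z p) (1 + size DNil + (1 + size p + q (size p) + 1) + 1)"
      unfolding body_def by simp
    moreover have "q (size p) \<le> q (10 * n + 10)" using DNil q(2) by (intro monoD[OF q(2)]) simp
    ultimately show ?case using DNil unfolding drec.simps by (elim eval_within_le) (simp add: B_def)
  next
    case (DPair a b)
    let ?\<rho> = "[a, b, DPair a b, p]" and ?y = "DPair a (DPair b p)"
    let ?N = "size a + size b + size p"
    have N: "?N < n" using DPair.prems by simp
    have v: "eval_within P' ?\<rho> (EVar 0) a (1 + size a)" "eval_within P' ?\<rho> (EVar 1) b (1 + size b)"
      "eval_within P' ?\<rho> (EVar 3) p (1 + size p)"
      by (rule eval_within_Var; simp)+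
    have y: "eval_within P' ?\<rho> (ECons (EVar 0) (ECons (EVar 1) (EVar 3))) ?y (8 + 3 * ?N)"
      by (rule eval_within_le[OF eval_within_Cons[OF v(1) eval_within_Cons[OF v(2,3)]]]) simp
    have qy: "q (size ?y) \<le> q (10 * n + 10)" using N by (intro monoD[OF q(2)]) simp
    have l: "eval_within P' ?\<rho> (ECall (idx ?l) [ECons (EVar 0) (ECons (EVar 1) (EVar 3))]) (l a b p)
        (9 + 3 * n + q (10 * n + 10))"
      using eval_within_le[OF computes_Call[OF P' q(2) y, of ?l]] qy N by simp
    have r: "eval_within P' ?\<rho> (ECall (idx ?r) [ECons (EVar 0) (ECons (EVar 1) (EVar 3))]) (r a b p)
        (9 + 3 * n + q (10 * n + 10))"
      using eval_within_le[OF computes_Call[OF P' q(2) y, of ?r]] qy N by simp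
    have sn: "size a + size (l a b p) \<le> n" "size b + size (r a b p) \<le> n"
      using sl[of a b p] sr[of a b p] DPair.prems by auto
    let ?s = "drec z g l r a (l a b p)" and ?t = "drec z g l r b (r a b p)"
    have st: "size ?s \<le> w n" "size ?t \<le> w n"
      using bnd(3) monoD[OF bnd(2)] sn order_trans by blast+
    note IH = DPair.IH(1)[OF sn(1)] DPair.IH(2)[OF sn(2)]
    note ra = eval_within_Call2[OF f(1) v(1) l IH(1)[folded f(2)]]
    note rb = eval_within_Call2[OF f(1) v(2) r IH(2)[folded f(2)]]
    let ?Y = "DPair a (DPair b (DPair p (DPair ?s ?t)))"
    note Y = eval_within_Cons[OF v(1) eval_within_Cons[OF v(2) eval_within_Cons[OF v(3) eval_within_Cons[OF ra rb]]]]
    have qY: "q (size ?Y) \<le> q (10 * n + 10 + 2 * w n)"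
      using N st by (intro monoD[OF q(2)]) simp
    have "eval_within P' ?\<rho> (ECall (idx ?g) [ECons (EVar 0) (ECons (EVar 1) (ECons (EVar 3) (ECons
       (ECall f [EVar 0, ECall (idx ?l) [ECons (EVar 0) (ECons (EVar 1) (EVar 3))]])
       (ECall f [EVar 1, ECall (idx ?r) [ECons (EVar 0) (ECons (EVar 1) (EVar 3))]]))))])
       (g a b p ?s ?t)
       ((2 * size a + 1) * B n + (2 * size b + 1) * B n + 40 * n + 80 + 10 * w n
         + 2 * q (10 * n + 10) + q (10 * n + 10 + 2 * w n))"
      using eval_within_le[OF computes_Call[OF P' q(2) Y, of ?g]] qY N st by simp
    from eval_within_Case_Pair[OF eval_within_Var[of 0 "[DPair a b, p]" "DPair a b"] this]
    have "eval_within P' [DPair a b, p] body (g a b p ?s ?t)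
       (1 + size (DPair a b) + ((2 * size a + 1) * B n + (2 * size b + 1) * B n + 40 * n + 80 + 10 * w n
         + 2 * q (10 * n + 10) + q (10 * n + 10 + 2 * w n)) + 1)"
      unfolding body_def by simp
    moreover have "1 + size (DPair a b) + ((2 * size a + 1) * B n + (2 * size b + 1) * B n + 40 * n + 80 + 10 * w n
         + 2 * q (10 * n + 10) + q (10 * n + 10 + 2 * w n)) + 1
       \<le> (2 * size a + 1) * B n + (2 * size b + 1) * B n + B n"
      using N unfolding B_def by simp
    moreover have "(2 * size a + 1) * B n + (2 * size b + 1) * B n + B n
       \<le> (2 * size (DPair a b) + 1) * B n"
      by (simp add: algebra_simps)
    ultimately show ?case unfolding drec.simps by (meson eval_within_le order_trans)
  qed
  have c: "eval_within P' [x] (ECall (idx H) [EVar 0]) (H x) (1 + size x + q (size x) + 1)"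
    and s: "size (H x) \<le> q (size x)" if "H \<in> set [u, v]" for H x
    using computes_Call[OF P' q(2) eval_within_Var, of H 0 "[x]" x] P'[of H] that
    unfolding computes_def by (auto dest: eval_within_size)
  define T where "T n = 2 * (n + q n + 2) + (2 * q n + 1) * B (2 * q n) + 1" for n
  have "eval_within P' [x] (ECall f [ECall (idx u) [EVar 0], ECall (idx v) [EVar 0]])
     (drec z g l r (u x) (v x)) (T (size x))" for x
  proof -
    have "size (u x) + size (v x) \<le> 2 * q (size x)" using s[of u x] s[of v x] by simp
    from eval_within_Call2[OF f(1) c[of u x] c[of v x] main[OF this, folded f(2)]]
    have "eval_within P' [x] (ECall f [ECall (idx u) [EVar 0], ECall (idx v) [EVar 0]])
      (drec z g l r (u x) (v x)) (1 + size x + q (size x) + 1 + (1 + size x + q (size x) + 1) +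
     (2 * size (u x) + 1) * B (2 * q (size x)) + 1)" by simp
    moreover have "(2 * size (u x) + 1) * B (2 * q (size x)) \<le> (2 * q (size x) + 1) * B (2 * q (size x))"
      using s[of u x] by (intro mult_le_mono1) simp
    ultimately show ?thesis by (elim eval_within_le) (simp add: T_def)
  qed
  moreover have "poly_bounded T"
  proof -
    have "poly_bounded B"
      unfolding B_def by (intro poly_bounded_intros poly_bounded_comp[OF q(1)] bnd(1))
    then show ?thesis
      unfolding T_def by (intro poly_bounded_intros poly_bounded_comp[of B "\<lambda>n. 2 * q n"] q(1))
  qed
  ultimately show ?thesis unfolding ptime_def by blast
qed

section \<open>Recursion on binary trees\<close>

text \<open>If results could be copied on their way up, they might double at every level. Here each
  node adds only a polynomial amount, so the result on a tree is bounded by a sum over its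
  nodes.\<close>

definition grows_additively :: "(data \<Rightarrow> data \<Rightarrow> data \<Rightarrow> data \<Rightarrow> data \<Rightarrow> data) \<Rightarrow> bool" where
  "grows_additively g \<longleftrightarrow> (\<exists>w. poly_bounded w \<and> mono w \<and>
     (\<forall>a b p r s. size (g a b p r s) \<le> size r + size s + w (size a + size b + size p)))"

lemma additiveI:
  assumes "poly_bounded w" "\<And>a b p r s. size (g a b p r s) \<le> size r + size s + w (size a + size b + size p)"
  shows "grows_additively g"
proof -
  obtain v where v: "poly_bounded v" "mono v" "\<And>n. w n \<le> v n"
    using poly_bounded_mono_bound[OF assms(1)] by blast
  have "size (g a b p r s) \<le> size r + size s + v (size a + size b + size p)" for a b p r s
    using assms(2)[of a b p r s] v(3)[of "size a + size b + size p"] by linarith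
  then show ?thesis using v(1,2) unfolding grows_additively_def by blast
qed

text \<open>The hypothesis expresses polynomial time for a function of three arguments. Applied to
  the projections of a packed triple, it yields a bound on the size of the value.\<close>

lemma ptime_size3:
  assumes "\<And>a b p. ptime a \<Longrightarrow> ptime b \<Longrightarrow> ptime p \<Longrightarrow> ptime (\<lambda>x. F (a x) (b x) (p x))"
  obtains q where "poly_bounded q" "\<And>a b p. size (F a b p) \<le> q (size a + size b + size p)"
proof -
  have "ptime (\<lambda>x. F (dfst x) (dfst (dsnd x)) (dsnd (dsnd x)))"
    by (intro assms ptime_dfst ptime_dsnd ptime_id)
  then obtain q where q: "poly_bounded q"
    "\<And>x. size (F (dfst x) (dfst (dsnd x)) (dsnd (dsnd x))) \<le> q (size x)"
    by (rule ptime_size) blast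
  show thesis
  proof (rule that[of "\<lambda>n. q (n + 2)"])
    show "poly_bounded (\<lambda>n. q (n + 2))" by (intro poly_bounded_comp[OF q(1)] poly_bounded_intros)
    show "size (F a b p) \<le> q (size a + size b + size p + 2)" for a b p
      using q(2)[of "DPair a (DPair b p)"] by (simp add: add.assoc)
  qed
qed

lemma grows_additively_pt:
  assumes "\<And>a b p. ptime a \<Longrightarrow> ptime b \<Longrightarrow> ptime p \<Longrightarrow> ptime (\<lambda>x. F (a x) (b x) (p x))"
  shows "grows_additively (\<lambda>a b p r s. F a b p)"
  by (rule ptime_size3[where F = F, OF assms], assumption+) (rule additiveI, assumption, simp add: trans_le_add2)

lemma grows_additively_right: "grows_additively (\<lambda>a b p r s. s)"
  by (rule additiveI[OF poly_bounded_id]) simp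

lemma grows_additively_if:
  assumes "grows_additively g" "grows_additively h"
  shows "grows_additively (\<lambda>a b p r s. if C a b p r s then g a b p r s else h a b p r s)"
proof -
  obtain v w where vw: "poly_bounded v" "poly_bounded w"
    and b: "\<And>a b p r s. size (g a b p r s) \<le> size r + size s + v (size a + size b + size p)"
      "\<And>a b p r s. size (h a b p r s) \<le> size r + size s + w (size a + size b + size p)"
    using assms unfolding grows_additively_def by blast
  show ?thesis
  proof (rule additiveI[OF poly_bounded_add[OF vw]])
    fix a b p r s :: data
    show "size (if C a b p r s then g a b p r s else h a b p r s) \<le> size r + size s +
         (v (size a + size b + size p) + w (size a + size b + size p))"
      using b[of a b p r s] by auto
  qed
qed

lemma grows_additively_DPair1:
  assumes "\<And>a b p. ptime a \<Longrightarrow> ptime b \<Longrightarrow> ptime p \<Longrightarrow> ptime (\<lambda>x. F (a x) (b x) (p x))" "grows_additively g"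
  shows "grows_additively (\<lambda>a b p r s. DPair (F a b p) (g a b p r s))"
proof -
  obtain v where v: "poly_bounded v" "\<And>a b p. size (F a b p) \<le> v (size a + size b + size p)"
    by (rule ptime_size3[where F = F, OF assms(1)]) auto
  obtain w where w: "poly_bounded w"
    "\<And>a b p r s. size (g a b p r s) \<le> size r + size s + w (size a + size b + size p)"
    using assms(2) unfolding grows_additively_def by blast
  show ?thesis
  proof (rule additiveI[of "\<lambda>n. v n + w n + 1"])
    fix a b p r s :: data
    show "size (DPair (F a b p) (g a b p r s)) \<le> size r + size s +
         (v (size a + size b + size p) + w (size a + size b + size p) + 1)"
      using v(2)[of a b p] w(2)[of a b p r s] by simp
  qed (intro poly_bounded_intros v w)
qed

lemma grows_additively_DPair2:
  assumes "\<And>a b p. ptime a \<Longrightarrow> ptime b \<Longrightarrow> ptime p \<Longrightarrow> ptime (\<lambda>x. F (a x) (b x) (p x))" "grows_additively g"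
  shows "grows_additively (\<lambda>a b p r s. DPair (g a b p r s) (F a b p))"
proof -
  obtain w where w: "poly_bounded w" "mono w"
    "\<And>a b p r s. size (DPair (F a b p) (g a b p r s)) \<le> size r + size s + w (size a + size b + size p)"
    using grows_additively_DPair1[of F g, OF assms] unfolding grows_additively_def by blast
  show ?thesis
    by (rule additiveI[OF w(1)]) (use w(3) in \<open>simp add: add.commute\<close>)
qed

text \<open>The parameter may grow along a branch only by what the recursion has consumed, so
  every parameter that is reached is bounded by the input.\<close>

lemma ptime_drec:
  assumes z: "\<And>p. ptime p \<Longrightarrow> ptime (\<lambda>x. z (p x))"
    and g: "\<And>a b p r s. ptime a \<Longrightarrow> ptime b \<Longrightarrow> ptime p \<Longrightarrow> ptime r \<Longrightarrow> ptime s \<Longrightarrow>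
      ptime (\<lambda>x. g (a x) (b x) (p x) (r x) (s x))"
    and l: "\<And>a b p. ptime a \<Longrightarrow> ptime b \<Longrightarrow> ptime p \<Longrightarrow> ptime (\<lambda>x. l (a x) (b x) (p x))"
    and r: "\<And>a b p. ptime a \<Longrightarrow> ptime b \<Longrightarrow> ptime p \<Longrightarrow> ptime (\<lambda>x. r (a x) (b x) (p x))"
    and sl: "\<And>a b p. size (l a b p) \<le> size b + size p + 1"
    and sr: "\<And>a b p. size (r a b p) \<le> size a + size p + 1"
    and add: "grows_additively g"
    and u: "ptime u" and v: "ptime v"
  shows "ptime (\<lambda>x. drec z g l r (u x) (v x))"
proof -
  obtain q where q: "poly_bounded q" "mono q" "\<And>p. size (z p) \<le> q (size p)"
    by (rule ptime_size[OF z[OF ptime_id]]) blast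
  obtain w where w: "poly_bounded w" "mono w"
    "\<And>a b p r s. size (g a b p r s) \<le> size r + size s + w (size a + size b + size p)"
    using add unfolding grows_additively_def by blast
  define W where "W n = q n + w n" for n
  have mW: "mono W" using q(2) w(2) unfolding W_def mono_def by (simp add: add_mono)
  have bnd: "size (drec z g l r x p) \<le> (2 * size x + 1) * W n" if "size x + size p \<le> n" for x p n
    using that
  proof (induction x arbitrary: p)
    case DNil
    then show ?case using q(3)[of p] monoD[OF q(2), of "size p" n] by (simp add: W_def)
  next
    case (DPair a b)
    let ?s = "drec z g l r a (l a b p)" and ?t = "drec z g l r b (r a b p)"
    have "size a + size (l a b p) \<le> n" "size b + size (r a b p) \<le> n"
      using sl[of a b p] sr[of a b p] DPair.prems by auto
    note IH = DPair.IH(1)[OF this(1)] DPair.IH(2)[OF this(2)]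
    have "w (size a + size b + size p) \<le> W n"
      using monoD[OF w(2), of "size a + size b + size p" n] DPair.prems by (simp add: W_def)
    then have "size (drec z g l r (DPair a b) p)
        \<le> (2 * size a + 1) * W n + (2 * size b + 1) * W n + W n"
      using IH w(3)[of a b p ?s ?t] by simp
    then show ?case by (simp add: algebra_simps)
  qed
  show ?thesis
  proof (rule ptime_drec_base)
    show "ptime z" by (rule z[OF ptime_id])
    show "poly_bounded (\<lambda>n. (2 * n + 1) * W n)"
      unfolding W_def by (intro poly_bounded_intros q w)
    show "mono (\<lambda>n. (2 * n + 1) * W n)"
      using mW by (intro monoI mult_le_mono) (auto simp: mono_def)
    show "size (drec z g l r x p) \<le> (2 * (size x + size p) + 1) * W (size x + size p)" for x p
      using bnd[of x p, OF order_refl] by (elim order_trans) simp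
  qed (intro g l r u v sl sr ptime_dfst ptime_dsnd ptime_id)+
qed

section \<open>Equality test and recursion along lists\<close>

definition dtrue :: data where "dtrue = DPair DNil DNil"

text \<open>The second tree is the parameter and is taken apart in step with the first;
  \<open>DNil\<close> stands for false.\<close>

definition deq :: "data \<Rightarrow> data \<Rightarrow> data" where
  "deq = drec (\<lambda>p. if p = DNil then dtrue else DNil)
     (\<lambda>a b p r s. if p = DNil then DNil else if r = DNil then DNil else s)
     (\<lambda>a b p. dfst p) (\<lambda>a b p. dsnd p)"

lemma deq_iff: "deq x y = DNil \<longleftrightarrow> x \<noteq> y"
proof (induction x arbitrary: y)
  case DNil
  then show ?case by (simp add: deq_def dtrue_def)
next
  case (DPair a b)
  then show ?case by (cases y) (simp_all add: deq_def)
qed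

lemma size_dfst: "size (dfst x) \<le> size x" and size_dsnd: "size (dsnd x) \<le> size x"
  by (cases x; simp)+

lemma ptime_deq: "ptime u \<Longrightarrow> ptime v \<Longrightarrow> ptime (\<lambda>x. deq (u x) (v x))"
  unfolding deq_def
  by (rule ptime_drec)
    (assumption | rule ptime_if_Nil ptime_const ptime_dfst ptime_dsnd grows_additively_if grows_additively_right grows_additively_pt
     | simp add: size_dfst size_dsnd le_SucI trans_le_add2)+

lemma ptime_if_eq:
  assumes "ptime a" "ptime b" "ptime u" "ptime v"
  shows "ptime (\<lambda>x. if a x = b x then u x else v x)"
proof -
  have "(\<lambda>x. if a x = b x then u x else v x) = (\<lambda>x. if deq (a x) (b x) = DNil then v x else u x)"
    by (auto simp: deq_iff)
  then show ?thesis using assms by (simp add: ptime_if_Nil ptime_deq)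
qed

lemmas ptime_intros = ptime_id ptime_const ptime_DPair ptime_dfst ptime_dsnd ptime_if_eq

text \<open>Encoded lists are right combs, so recursion along a list is tree recursion that keeps
  only the result on the right component.\<close>

definition dfold :: "(data \<Rightarrow> data) \<Rightarrow> (data \<Rightarrow> data \<Rightarrow> data \<Rightarrow> data \<Rightarrow> data) \<Rightarrow> data \<Rightarrow> data \<Rightarrow> data" where
  "dfold z g = drec z (\<lambda>a b p r s. g a b p s) (\<lambda>a b p. DNil) (\<lambda>a b p. p)"

lemma dfold_simps [simp]:
  "dfold z g DNil p = z p"
  "dfold z g (DPair a b) p = g a b p (dfold z g b p)"
  by (simp_all add: dfold_def)

lemma ptime_dfold:
  assumes z: "\<And>p. ptime p \<Longrightarrow> ptime (\<lambda>x. z (p x))"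
    and g: "\<And>a b p s. ptime a \<Longrightarrow> ptime b \<Longrightarrow> ptime p \<Longrightarrow> ptime s \<Longrightarrow>
      ptime (\<lambda>x. g (a x) (b x) (p x) (s x))"
    and add: "grows_additively (\<lambda>a b p r s. g a b p s)"
    and u: "ptime u" and v: "ptime v"
  shows "ptime (\<lambda>x. dfold z g (u x) (v x))"
  unfolding dfold_def
  by (rule ptime_drec) (use assms in \<open>auto intro: ptime_const\<close>)

definition dapp :: "data \<Rightarrow> data \<Rightarrow> data" where
  "dapp = dfold (\<lambda>p. p) (\<lambda>a b p s. DPair a s)"

lemma dapp_enc: "dapp (enc_list xs) (enc_list ys) = enc_list (xs @ ys)"
  by (induction xs) (simp_all add: dapp_def)

lemma size_dapp: "size (dapp x y) = size x + size y"
  by (induction x) (simp_all add: dapp_def)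

lemma ptime_dapp: "ptime u \<Longrightarrow> ptime v \<Longrightarrow> ptime (\<lambda>x. dapp (u x) (v x))"
  unfolding dapp_def by (rule ptime_dfold) (assumption | rule ptime_intros grows_additively_DPair1 grows_additively_right)+

lemma grows_additively_dapp:
  assumes "\<And>a b p. ptime a \<Longrightarrow> ptime b \<Longrightarrow> ptime p \<Longrightarrow> ptime (\<lambda>x. F (a x) (b x) (p x))" "grows_additively g"
  shows "grows_additively (\<lambda>a b p r s. dapp (F a b p) (g a b p r s))"
proof -
  obtain w where w: "poly_bounded w" "mono w"
    "\<And>a b p r s. size (DPair (F a b p) (g a b p r s)) \<le> size r + size s + w (size a + size b + size p)"
    using grows_additively_DPair1[of F g, OF assms] unfolding grows_additively_def by blast
  show ?thesis
    by (rule additiveI[OF w(1)]) (use w(3) in \<open>simp add: size_dapp Suc_leD\<close>)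
qed

lemma grows_additively_dapp_both: "grows_additively (\<lambda>a b p r s. dapp r s)"
  by (rule additiveI[OF poly_bounded_id]) (simp add: size_dapp)

section \<open>The extraction algorithm\<close>

type_synonym wproof = "wsequent ptree"
type_synonym clause = "fm list \<times> fm \<times> wproof"

abbreviation (input) body :: "clause \<Rightarrow> fm list" where "body c \<equiv> fst c"
abbreviation (input) head :: "clause \<Rightarrow> fm" where "head c \<equiv> fst (snd c)"
abbreviation (input) certificate :: "clause \<Rightarrow> wproof" where "certificate c \<equiv> snd (snd c)"

primrec subproofs :: "wproof \<Rightarrow> wproof list" where
  "subproofs (Node S ts) = Node S ts # concat (map subproofs ts)"

primrec subformulas :: "fm \<Rightarrow> fm list" where
  "subformulas (Atom n) = [Atom n]"
| "subformulas Top = [Top]"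
| "subformulas Bot = [Bot]"
| "subformulas (And A B) = And A B # subformulas A @ subformulas B"
| "subformulas (Or A B) = Or A B # subformulas A @ subformulas B"
| "subformulas (Imp A B) = Imp A B # subformulas A @ subformulas B"
| "subformulas (Box A) = Box A # subformulas A"
| "subformulas (Dia A) = Dia A # subformulas A"

primrec formulas :: "wproof \<Rightarrow> fm list" where
  "formulas (Node S ts) = (concat (map subformulas (fst S)) @ concat (map subformulas (snd S)))
     @ concat (map formulas ts)"

primrec is_harrop :: "fm \<Rightarrow> bool" where
  "is_harrop (Atom n) = True"
| "is_harrop Top = True"
| "is_harrop Bot = True"
| "is_harrop (And A B) = (is_harrop A \<and> is_harrop B)"
| "is_harrop (Or A B) = False"
| "is_harrop (Imp A B) = is_harrop B"
| "is_harrop (Box A) = is_harrop A"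
| "is_harrop (Dia A) = False"

text \<open>The Horn sequents are written with the atoms 0 and 1. A proof of one of them may contain
  further atoms, and sending these to \<open>B\<close> is as good as any other choice.\<close>

definition pair_subst :: "fm \<Rightarrow> fm \<Rightarrow> nat \<Rightarrow> fm" where
  "pair_subst A B n = (if n = 0 then A else B)"

definition subst_wproof :: "(nat \<Rightarrow> fm) \<Rightarrow> wproof \<Rightarrow> wproof" where
  "subst_wproof \<sigma> = map_ptree (map_prod (map (fm_subst \<sigma>)) (map (fm_subst \<sigma>)))"

text \<open>Right weakening by \<open>Bot\<close> gives a head to sequents with empty
  succedent.\<close>

definition mk_clause :: "wproof \<Rightarrow> clause" where
  "mk_clause t = (let X = fst (root_label t) in case snd (root_label t) of
     [] \<Rightarrow> (X, Bot, Node (X, [Bot]) [t]) | F # _ \<Rightarrow> (X, F, t))"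

definition instances :: "wproof list \<Rightarrow> fm list \<Rightarrow> wproof list" where
  "instances T S = concat (map (\<lambda>A. concat (map (\<lambda>B. map (subst_wproof (pair_subst A B)) T) S)) S)"

definition clauses :: "wproof list \<Rightarrow> wproof \<Rightarrow> clause list" where
  "clauses T \<pi> = map mk_clause (subproofs \<pi> @ instances T (formulas \<pi>))"

definition marked :: "clause list \<Rightarrow> fm list \<Rightarrow> fm list" where
  "marked s \<Sigma> = map (\<lambda>c. head c) s @ \<Sigma>"

text \<open>The clauses that fired are kept, latest first, rather than only the marked formulas:
  this list is the plan from which \<open>cuts\<close> builds a proof.\<close>

definition saturate :: "clause list \<Rightarrow> fm list \<Rightarrow> clause list" where
  "saturate L \<Sigma> = foldr (\<lambda>c s. if set (body c) \<subseteq> set (marked s \<Sigma>) then c # s else s) L []"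

primrec weaken :: "fm list \<Rightarrow> clause \<Rightarrow> wproof" where
  "weaken [] c = certificate c"
| "weaken (A # X) c = Node ((A # X) @ body c, [head c]) [weaken X c]"

text \<open>From the root upwards, the body of the clause moves from the first argument to the
  second one, so that the premise of each contraction is determined.\<close>

primrec contract :: "fm list \<Rightarrow> fm list \<Rightarrow> fm list \<Rightarrow> clause \<Rightarrow> wproof" where
  "contract [] Y X c = weaken X c"
| "contract (A # Z) Y X c = Node (Y @ X, [head c]) [contract Z (A # Y) X c]"

definition adapt :: "fm list \<Rightarrow> clause \<Rightarrow> wproof" where
  "adapt X c = contract (body c) [] X c"

text \<open>The right spine adds one marked formula per cut, in the order of firing, and ends in an
  identity axiom. Each left premise contains only the certificate of its clause, so derivations of
  formulas marked earlier are never copied.\<close>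

primrec cuts :: "clause list \<Rightarrow> clause list \<Rightarrow> fm list \<Rightarrow> fm \<Rightarrow> wproof" where
  "cuts [] s \<Sigma> F = Node (marked s \<Sigma>, [F]) []"
| "cuts (c # cs) s \<Sigma> F =
     Node (marked s \<Sigma>, [F]) [adapt (marked s \<Sigma>) c, cuts cs (c # s) \<Sigma> F]"

text \<open>The splitting of the antecedent is not given. Formulas that are not Harrop lie on the
  implication side of every splitting; an implication that is Harrop is treated as a Harrop
  formula.\<close>

definition antecedents :: "fm \<Rightarrow> fm list" where
  "antecedents H = (case H of Imp A B \<Rightarrow> if is_harrop H then [] else [A] | _ \<Rightarrow> [])"

text \<open>The value \<open>\<pi>\<close> is a default for the case that no candidate is
  marked.\<close>

definition find_proof :: "clause list \<Rightarrow> fm list \<Rightarrow> fm list \<Rightarrow> wproof \<Rightarrow> wproof" where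
  "find_proof s \<Sigma> Fs \<pi> = (case dropWhile (\<lambda>F. F \<notin> set (marked s \<Sigma>)) Fs of
     [] \<Rightarrow> \<pi> | F # _ \<Rightarrow> cuts (rev s) [] \<Sigma> F)"

text \<open>One pass over \<open>length L\<close> copies of \<open>L\<close> amounts to
  \<open>length L\<close> rounds of saturation.\<close>

definition split_disjunction :: "wproof list \<Rightarrow> wproof \<Rightarrow> wproof" where
  "split_disjunction T \<pi> = (let \<Sigma> = fst (root_label \<pi>); L = clauses T \<pi>;
       s = saturate (concat (map (\<lambda>_. L) L)) \<Sigma> in
     case snd (root_label \<pi>) of
       [Or C D] \<Rightarrow> find_proof s \<Sigma> (C # D # concat (map antecedents \<Sigma>)) \<pi>
     | _ \<Rightarrow> \<pi>)"

section \<open>Encoded data: injectivity and list procedures\<close>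

lemma enc_nat_inject [simp]: "enc_nat m = enc_nat n \<longleftrightarrow> m = n"
proof (induction m arbitrary: n rule: less_induct)
  case (less m)
  have *: "m div 2 < m" if "m \<noteq> 0" using that by simp
  show ?case
  proof
    assume eq: "enc_nat m = enc_nat n"
    show "m = n"
    proof (cases "m = 0 \<or> n = 0")
      case True
      then show ?thesis using eq enc_nat.simps[of m] enc_nat.simps[of n] by (auto split: if_splits)
    next
      case False
      then have "enc_nat (m div 2) = enc_nat (n div 2)" "even m = even n"
        using eq enc_nat.simps[of m] enc_nat.simps[of n] by (auto split: if_splits)
      then have "m div 2 = n div 2" "m mod 2 = n mod 2"
        using less[OF *] False by (auto simp: mod2_eq_if)
      then show ?thesis by (metis div_mult_mod_eq)
    qed
  qed simp
qed

lemma enc_fm_inject [simp]: "enc_fm A = enc_fm B \<longleftrightarrow> A = B"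
  by (induction A arbitrary: B) (case_tac B; simp)+

lemma enc_list_eq_DNil [simp]: "enc_list xs = DNil \<longleftrightarrow> xs = []"
  by (cases xs) simp_all

definition enc_fms :: "fm list \<Rightarrow> data" where "enc_fms X = enc_list (map enc_fm X)"

definition enc_clause :: "clause \<Rightarrow> data" where
  "enc_clause c = DPair (enc_fms (body c)) (DPair (enc_fm (head c)) (enc_ptree (certificate c)))"

lemma enc_fms_simps [simp]:
  "enc_fms [] = DNil" "enc_fms (A # X) = DPair (enc_fm A) (enc_fms X)"
  by (simp_all add: enc_fms_def)

lemma enc_wsequent: "enc_wsequent S = DPair (enc_fms (fst S)) (enc_fms (snd S))"
  by (simp add: enc_wsequent_def enc_fms_def)

lemma dapp_fms: "dapp (enc_fms X) (enc_fms Y) = enc_fms (X @ Y)"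
  by (simp add: enc_fms_def dapp_enc)

definition dflat :: "(data \<Rightarrow> data \<Rightarrow> data) \<Rightarrow> data \<Rightarrow> data \<Rightarrow> data" where
  "dflat f = dfold (\<lambda>p. DNil) (\<lambda>a b p s. dapp (f a p) s)"

lemma dflat_enc:
  assumes "\<And>x. x \<in> set xs \<Longrightarrow> f (enc x) p = enc_list (map enc' (g x))"
  shows "dflat f (enc_list (map enc xs)) p = enc_list (map enc' (concat (map g xs)))"
  using assms by (induction xs) (simp_all add: dflat_def dapp_enc)

lemma ptime_dflat:
  assumes f: "\<And>a p. ptime a \<Longrightarrow> ptime p \<Longrightarrow> ptime (\<lambda>x. f (a x) (p x))" and "ptime u" "ptime v"
  shows "ptime (\<lambda>x. dflat f (u x) (v x))"
  unfolding dflat_def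
  by (rule ptime_dfold) (assumption | rule assms ptime_const ptime_dapp grows_additively_dapp grows_additively_right)+

definition dmap :: "(data \<Rightarrow> data) \<Rightarrow> data \<Rightarrow> data" where
  "dmap f x = dfold (\<lambda>p. DNil) (\<lambda>a b p s. DPair (f a) s) x DNil"

lemma dmap_enc:
  assumes "\<And>x. x \<in> set xs \<Longrightarrow> f (enc x) = enc' (g x)"
  shows "dmap f (enc_list (map enc xs)) = enc_list (map enc' (map g xs))"
  using assms by (induction xs) (simp_all add: dmap_def)

lemma ptime_dmap:
  assumes f: "\<And>a. ptime a \<Longrightarrow> ptime (\<lambda>x. f (a x))" and "ptime u"
  shows "ptime (\<lambda>x. dmap f (u x))"
  unfolding dmap_def
  by (rule ptime_dfold) (assumption | rule assms ptime_const ptime_DPair grows_additively_DPair1 grows_additively_right)+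

text \<open>The accumulator grows by exactly the element that has been consumed, which is what
  \<open>ptime_drec\<close> permits.\<close>

definition drev :: "data \<Rightarrow> data \<Rightarrow> data" where
  "drev = drec (\<lambda>p. p) (\<lambda>a b p r s. s) (\<lambda>a b p. DNil) (\<lambda>a b p. DPair a p)"

lemma drev_enc: "drev (enc_list xs) (enc_list ys) = enc_list (rev xs @ ys)"
proof (induction xs arbitrary: ys)
  case (Cons x xs)
  show ?case using Cons[of "x # ys"] by (simp add: drev_def)
qed (simp add: drev_def)

lemma ptime_drev: "ptime u \<Longrightarrow> ptime v \<Longrightarrow> ptime (\<lambda>x. drev (u x) (v x))"
  unfolding drev_def
  by (rule ptime_drec) (assumption | rule ptime_intros grows_additively_right | simp)+

definition dmem :: "data \<Rightarrow> data \<Rightarrow> data" where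
  "dmem y x = dfold (\<lambda>p. DNil) (\<lambda>a b p s. if a = p then dtrue else s) x y"

lemma dtrue_neq [simp]: "dtrue \<noteq> DNil" "DNil \<noteq> dtrue" by (simp_all add: dtrue_def)

lemma dmem_enc: "dmem (enc_fm A) (enc_fms X) = (if A \<in> set X then dtrue else DNil)"
  by (induction X) (auto simp: dmem_def)

lemma ptime_dmem: "ptime u \<Longrightarrow> ptime v \<Longrightarrow> ptime (\<lambda>x. dmem (u x) (v x))"
  unfolding dmem_def
  by (rule ptime_dfold) (assumption | rule ptime_intros grows_additively_if grows_additively_right grows_additively_pt)+

definition dsubset :: "data \<Rightarrow> data \<Rightarrow> data" where
  "dsubset = dfold (\<lambda>p. dtrue) (\<lambda>a b p s. if dmem a p = DNil then DNil else s)"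

lemma dsubset_enc: "dsubset (enc_fms X) (enc_fms Y) = (if set X \<subseteq> set Y then dtrue else DNil)"
  by (induction X) (auto simp: dsubset_def dmem_enc)

lemma ptime_dsubset: "ptime u \<Longrightarrow> ptime v \<Longrightarrow> ptime (\<lambda>x. dsubset (u x) (v x))"
  unfolding dsubset_def
  by (rule ptime_dfold) (assumption | rule ptime_intros ptime_dmem grows_additively_if grows_additively_right grows_additively_pt)+

text \<open>The traversals below are single tree recursions over encodings. Their parameter, a mode,
  says what the current subtree encodes. All modes have the same size, since a parameter of
  \<^const>\<open>drec\<close> may hardly grow.\<close>

definition "m_tree = DPair (DPair (DPair (DPair DNil DNil) DNil) DNil) DNil"
definition "m_forest = DPair (DPair (DPair DNil (DPair DNil DNil)) DNil) DNil"
definition "m_sequent = DPair (DPair DNil (DPair (DPair DNil DNil) DNil)) DNil"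
definition "m_list = DPair (DPair DNil (DPair DNil (DPair DNil DNil))) DNil"
definition "m_formula = DPair DNil (DPair (DPair (DPair DNil DNil) DNil) DNil)"
definition "m_pair = DPair DNil (DPair (DPair DNil (DPair DNil DNil)) DNil)"
definition "m_right = DPair DNil (DPair DNil (DPair (DPair DNil DNil) DNil))"

lemmas mode_defs = m_tree_def m_forest_def m_sequent_def m_list_def m_formula_def m_pair_def
  m_right_def

lemma size_modes:
  "size m_tree = 4" "size m_forest = 4" "size m_sequent = 4" "size m_list = 4"
  "size m_formula = 4" "size m_pair = 4" "size m_right = 4"
  by (simp_all add: mode_defs)

lemma mode_distinct:
  "distinct [DNil, m_tree, m_forest, m_sequent, m_list, m_formula, m_pair, m_right]"
  "distinct (rev [DNil, m_tree, m_forest, m_sequent, m_list, m_formula, m_pair, m_right])"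
  by (simp_all add: mode_defs)

lemmas mode_neq [simp] = mode_distinct[simplified]

definition dsubproofs :: "data \<Rightarrow> data \<Rightarrow> data" where
  "dsubproofs = drec (\<lambda>p. DNil)
     (\<lambda>a b p r s. if p = m_tree then DPair (DPair a b) s else if p = m_forest then dapp r s else DNil)
     (\<lambda>a b p. if p = m_forest then m_tree else DNil)
     (\<lambda>a b p. if p = m_tree then m_forest else if p = m_forest then m_forest else DNil)"

lemma dsubproofs_forest:
  assumes "\<And>t. t \<in> set ts \<Longrightarrow> dsubproofs (enc_ptree t) m_tree = enc_list (map enc_ptree (subproofs t))"
  shows "dsubproofs (enc_list (map enc_ptree ts)) m_forest =
    enc_list (map enc_ptree (concat (map subproofs ts)))"
  using assms
proof (induction ts)
  case (Cons t ts)
  have "dsubproofs (enc_ptree t) m_tree = enc_list (map enc_ptree (subproofs t))"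
    "dsubproofs (enc_list (map enc_ptree ts)) m_forest =
      enc_list (map enc_ptree (concat (map subproofs ts)))"
    using Cons by auto
  then show ?case by (simp add: dsubproofs_def dapp_enc)
qed (simp add: dsubproofs_def)

lemma dsubproofs_enc: "dsubproofs (enc_ptree t) m_tree = enc_list (map enc_ptree (subproofs t))"
proof (induction t)
  case (Node S ts)
  then show ?case using dsubproofs_forest[of ts] by (simp add: dsubproofs_def)
qed

lemma ptime_dsubproofs: "ptime u \<Longrightarrow> ptime v \<Longrightarrow> ptime (\<lambda>x. dsubproofs (u x) (v x))"
  unfolding dsubproofs_def
  by (rule ptime_drec)
    (assumption | rule ptime_intros ptime_dapp grows_additively_if grows_additively_DPair1 grows_additively_dapp_both
       grows_additively_right grows_additively_pt | simp add: size_modes)+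

text \<open>The mode of the right component is read off from the tag in the left one. Only tags of
  compound formulas lead to modes that look for formulas again, so the number of an atom is not
  mistaken for a formula; mode \<open>DNil\<close> switches the collection off.\<close>

definition dformulas :: "data \<Rightarrow> data \<Rightarrow> data" where
  "dformulas = drec (\<lambda>p. DNil)
     (\<lambda>a b p r s. if p = m_formula then DPair (DPair a b) s else dapp r s)
     (\<lambda>a b p. if p = m_forest then m_tree else if p = m_tree then m_sequent
        else if p = m_sequent then m_list else if p = m_list then m_formula
        else if p = m_pair then m_formula else DNil)
     (\<lambda>a b p. if p = m_forest then m_forest else if p = m_tree then m_forest
        else if p = m_sequent then m_list else if p = m_list then m_list
        else if p = m_pair then m_formula
        else if p = m_formula then
          (if a = enc_nat 3 then m_pair else if a = enc_nat 4 then m_pair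
           else if a = enc_nat 5 then m_pair else if a = enc_nat 6 then m_formula
           else if a = enc_nat 7 then m_formula else DNil)
        else DNil)"

lemma dapp_DNil [simp]: "dapp DNil x = x"
  by (simp add: dapp_def)

lemma dformulas_none: "dformulas x DNil = DNil"
  by (induction x) (simp_all add: dformulas_def)

lemma dformulas_DNil: "dformulas DNil p = DNil"
  by (simp add: dformulas_def)

lemma dformulas_step:
  "dformulas (DPair a b) m_forest = dapp (dformulas a m_tree) (dformulas b m_forest)"
  "dformulas (DPair a b) m_tree = dapp (dformulas a m_sequent) (dformulas b m_forest)"
  "dformulas (DPair a b) m_sequent = dapp (dformulas a m_list) (dformulas b m_list)"
  "dformulas (DPair a b) m_list = dapp (dformulas a m_formula) (dformulas b m_list)"
  "dformulas (DPair a b) m_pair = dapp (dformulas a m_formula) (dformulas b m_formula)"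
  by (simp_all add: dformulas_def)

lemma dformulas_formula:
  "dformulas (DPair a b) m_formula = DPair (DPair a b) (dformulas b
     (if a \<in> {enc_nat 3, enc_nat 4, enc_nat 5} then m_pair
      else if a \<in> {enc_nat 6, enc_nat 7} then m_formula else DNil))"
  by (simp add: dformulas_def)

lemma dformulas_fm: "dformulas (enc_fm A) m_formula = enc_fms (subformulas A)"
  by (induction A)
    (simp_all add: dformulas_formula dformulas_step dformulas_none dformulas_DNil dapp_fms)

lemma dformulas_fms: "dformulas (enc_fms X) m_list = enc_fms (concat (map subformulas X))"
  by (induction X) (simp_all add: dformulas_step dformulas_DNil dformulas_fm dapp_fms)

lemma dformulas_forest:
  assumes "\<And>t. t \<in> set ts \<Longrightarrow> dformulas (enc_ptree t) m_tree = enc_fms (formulas t)"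
  shows "dformulas (enc_list (map enc_ptree ts)) m_forest = enc_fms (concat (map formulas ts))"
  using assms by (induction ts) (simp_all add: dformulas_DNil dformulas_step dapp_fms)

lemma dformulas_enc: "dformulas (enc_ptree t) m_tree = enc_fms (formulas t)"
proof (induction t)
  case (Node S ts)
  then show ?case using dformulas_forest[of ts]
    by (simp add: dformulas_step enc_wsequent dformulas_fms dapp_fms)
qed

lemma ptime_dformulas: "ptime u \<Longrightarrow> ptime v \<Longrightarrow> ptime (\<lambda>x. dformulas (u x) (v x))"
  unfolding dformulas_def
  by (rule ptime_drec)
    (assumption | rule ptime_intros ptime_dapp grows_additively_if grows_additively_DPair1 grows_additively_dapp_both
       grows_additively_right grows_additively_pt | simp add: size_modes)+

text \<open>\<open>m_right\<close> passes over the antecedent of an implication, on which the Harrop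
  condition places no demand, whereas \<open>m_pair\<close> tests both components of a
  conjunction.\<close>

definition dharrop :: "data \<Rightarrow> data \<Rightarrow> data" where
  "dharrop = drec (\<lambda>p. DNil)
     (\<lambda>a b p r s. if p = m_formula then
        (if a = enc_nat 0 then dtrue else if a = enc_nat 1 then dtrue
         else if a = enc_nat 2 then dtrue else if a = enc_nat 4 then DNil
         else if a = enc_nat 7 then DNil else s)
      else if p = m_pair then (if r = DNil then DNil else s) else s)
     (\<lambda>a b p. if p = m_pair then m_formula else DNil)
     (\<lambda>a b p. if p = m_formula then
         (if a = enc_nat 3 then m_pair else if a = enc_nat 5 then m_right else m_formula)
       else if p = m_pair then m_formula else if p = m_right then m_formula else DNil)"

lemma dharrop_step:
  "dharrop (DPair a b) m_pair = (if dharrop a m_formula = DNil then DNil else dharrop b m_formula)"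
  "dharrop (DPair a b) m_right = dharrop b m_formula"
  by (simp_all add: dharrop_def)

lemma dharrop_formula:
  "dharrop (DPair a b) m_formula = (if a \<in> {enc_nat 0, enc_nat 1, enc_nat 2} then dtrue
     else if a \<in> {enc_nat 4, enc_nat 7} then DNil else dharrop b
     (if a = enc_nat 3 then m_pair else if a = enc_nat 5 then m_right else m_formula))"
  by (simp add: dharrop_def)

lemma dharrop_enc: "dharrop (enc_fm A) m_formula = (if is_harrop A then dtrue else DNil)"
  by (induction A) (simp_all add: dharrop_formula dharrop_step)

lemma ptime_dharrop: "ptime u \<Longrightarrow> ptime v \<Longrightarrow> ptime (\<lambda>x. dharrop (u x) (v x))"
  unfolding dharrop_def
  by (rule ptime_drec)
    (assumption | rule ptime_intros grows_additively_if grows_additively_right grows_additively_pt | simp add: size_modes)+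

section \<open>The algorithm runs in polynomial time\<close>

text \<open>The proofs in \<open>T\<close> are fixed, so each can be compiled into its own program,
  which assembles the code of an instance from the codes of \<open>A\<close> and \<open>B\<close>.
  The machine never has to substitute into a proof that it reads.\<close>

definition template :: "(fm \<Rightarrow> fm \<Rightarrow> data) \<Rightarrow> bool" where
  "template E \<longleftrightarrow> (\<exists>F. (\<forall>u v. ptime u \<longrightarrow> ptime v \<longrightarrow> ptime (\<lambda>x. F (u x) (v x))) \<and>
     (\<forall>A B. F (enc_fm A) (enc_fm B) = E A B))"

lemma template_const: "template (\<lambda>A B. c)"
  unfolding template_def by (intro exI[of _ "\<lambda>a b. c"]) (simp add: ptime_const)

lemma template_fst: "template (\<lambda>A B. enc_fm A)"
  unfolding template_def by (intro exI[of _ "\<lambda>a b. a"]) simp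

lemma template_snd: "template (\<lambda>A B. enc_fm B)"
  unfolding template_def by (intro exI[of _ "\<lambda>a b. b"]) simp

lemma template_DPair:
  assumes "template E" "template E'" shows "template (\<lambda>A B. DPair (E A B) (E' A B))"
proof -
  obtain F F' where F: "\<And>u v. ptime u \<Longrightarrow> ptime v \<Longrightarrow> ptime (\<lambda>x. F (u x) (v x))"
      "\<And>A B. F (enc_fm A) (enc_fm B) = E A B"
    and F': "\<And>u v. ptime u \<Longrightarrow> ptime v \<Longrightarrow> ptime (\<lambda>x. F' (u x) (v x))"
      "\<And>A B. F' (enc_fm A) (enc_fm B) = E' A B"
    using assms unfolding template_def by blast
  show ?thesis unfolding template_def
    by (intro exI[of _ "\<lambda>a b. DPair (F a b) (F' a b)"]) (simp add: F F' ptime_DPair)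
qed

lemma template_list:
  "(\<And>x. x \<in> set xs \<Longrightarrow> template (E x)) \<Longrightarrow> template (\<lambda>A B. enc_list (map (\<lambda>x. E x A B) xs))"
  by (induction xs) (simp_all add: template_const template_DPair)

lemma template_fm: "template (\<lambda>A B. enc_fm (fm_subst (pair_subst A B) C))"
proof (induction C)
  case (Atom n)
  then show ?case by (cases "n = 0") (simp_all add: pair_subst_def template_fst template_snd)
qed (simp_all add: template_const template_DPair)

lemma template_wproof: "template (\<lambda>A B. enc_ptree (subst_wproof (pair_subst A B) t))"
proof (induction t)
  case (Node S ts)
  have fms: "template (\<lambda>A B. enc_list (map (\<lambda>C. enc_fm (fm_subst (pair_subst A B) C)) X))" for X
    by (intro template_list template_fm)
  show ?case using template_DPair[OF template_DPair[OF fms fms] template_list[OF Node]]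
    by (simp add: subst_wproof_def enc_wsequent_def comp_def)
qed

lemma template_wproofs:
  "template (\<lambda>A B. enc_list (map enc_ptree (map (subst_wproof (pair_subst A B)) T)))"
  using template_list[of T "\<lambda>t A B. enc_ptree (subst_wproof (pair_subst A B) t)"] template_wproof
  by (simp add: comp_def)

text \<open>\<open>dflat\<close> hands a single parameter to its function: the outer loop passes on
  the list for the inner loop, and the inner loop receives the current \<open>A\<close>.\<close>

definition dinstances :: "(data \<Rightarrow> data \<Rightarrow> data) \<Rightarrow> data \<Rightarrow> data" where
  "dinstances F S = dflat (\<lambda>a S'. dflat (\<lambda>b a'. F a' b) S' a) S S"

lemma dinstances_enc:
  assumes "\<And>A B. F (enc_fm A) (enc_fm B) =
    enc_list (map enc_ptree (map (subst_wproof (pair_subst A B)) T))"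
  shows "dinstances F (enc_fms S) = enc_list (map enc_ptree (instances T S))"
  unfolding dinstances_def instances_def enc_fms_def
  by (intro dflat_enc assms)

lemma ptime_dinstances:
  assumes "\<And>u v. ptime u \<Longrightarrow> ptime v \<Longrightarrow> ptime (\<lambda>x. F (u x) (v x))" "ptime u"
  shows "ptime (\<lambda>x. dinstances F (u x))"
  unfolding dinstances_def by (intro ptime_dflat assms)

definition dmk_clause :: "data \<Rightarrow> data" where
  "dmk_clause t = (if dsnd (dfst t) = DNil
     then DPair (dfst (dfst t)) (DPair (enc_fm Bot)
       (DPair (DPair (dfst (dfst t)) (DPair (enc_fm Bot) DNil)) (DPair t DNil)))
     else DPair (dfst (dfst t)) (DPair (dfst (dsnd (dfst t))) t))"

lemma dmk_clause_enc: "dmk_clause (enc_ptree t) = enc_clause (mk_clause t)"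
  by (cases t; cases "snd (root_label t)")
    (simp_all add: dmk_clause_def mk_clause_def enc_clause_def enc_wsequent Let_def)

lemma ptime_dmk_clause: "ptime u \<Longrightarrow> ptime (\<lambda>x. dmk_clause (u x))"
  unfolding dmk_clause_def by (intro ptime_intros)

definition dclauses :: "(data \<Rightarrow> data \<Rightarrow> data) \<Rightarrow> data \<Rightarrow> data" where
  "dclauses F \<pi> = dmap dmk_clause
     (dapp (dsubproofs \<pi> m_tree) (dinstances F (dformulas \<pi> m_tree)))"

definition enc_clauses :: "clause list \<Rightarrow> data" where "enc_clauses L = enc_list (map enc_clause L)"

lemma enc_clauses_simps [simp]:
  "enc_clauses [] = DNil" "enc_clauses (c # L) = DPair (enc_clause c) (enc_clauses L)"
  by (simp_all add: enc_clauses_def)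

lemma enc_fms_eq_DNil [simp]: "enc_fms X = DNil \<longleftrightarrow> X = []"
  by (cases X) simp_all

lemma dclauses_enc:
  assumes "\<And>A B. F (enc_fm A) (enc_fm B) =
    enc_list (map enc_ptree (map (subst_wproof (pair_subst A B)) T))"
  shows "dclauses F (enc_ptree \<pi>) = enc_clauses (clauses T \<pi>)"
  unfolding dclauses_def clauses_def enc_clauses_def
  by (simp only: dsubproofs_enc dformulas_enc dinstances_enc[OF assms] dapp_enc map_append[symmetric])
    (intro dmap_enc dmk_clause_enc)

lemma ptime_dclauses:
  assumes "\<And>u v. ptime u \<Longrightarrow> ptime v \<Longrightarrow> ptime (\<lambda>x. F (u x) (v x))" "ptime u"
  shows "ptime (\<lambda>x. dclauses F (u x))"
  unfolding dclauses_def
  by (intro ptime_dmap ptime_dmk_clause ptime_dapp ptime_dsubproofs ptime_dformulas ptime_dinstances ptime_const assms)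

definition dmarked :: "data \<Rightarrow> data \<Rightarrow> data" where
  "dmarked s \<Sigma> = dapp (dmap (\<lambda>c. dfst (dsnd c)) s) \<Sigma>"

lemma dmarked_enc: "dmarked (enc_clauses s) (enc_fms \<Sigma>) = enc_fms (marked s \<Sigma>)"
proof -
  have "dmap (\<lambda>c. dfst (dsnd c)) (enc_clauses s) = enc_fms (map (\<lambda>c. head c) s)"
    unfolding enc_clauses_def enc_fms_def by (intro dmap_enc) (simp add: enc_clause_def)
  then show ?thesis by (simp add: dmarked_def marked_def dapp_fms)
qed

lemma ptime_dmarked: "ptime u \<Longrightarrow> ptime v \<Longrightarrow> ptime (\<lambda>x. dmarked (u x) (v x))"
  unfolding dmarked_def by (intro ptime_dapp ptime_dmap ptime_dfst ptime_dsnd)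

definition dsaturate :: "data \<Rightarrow> data \<Rightarrow> data" where
  "dsaturate = dfold (\<lambda>p. DNil)
     (\<lambda>a b p s. if dsubset (dfst a) (dmarked s p) = DNil then s else DPair a s)"

lemma dsaturate_enc: "dsaturate (enc_clauses L) (enc_fms \<Sigma>) = enc_clauses (saturate L \<Sigma>)"
proof (induction L)
  case (Cons c L)
  have c: "dfst (enc_clause c) = enc_fms (body c)" by (simp add: enc_clause_def)
  show ?case using Cons by (simp add: dsaturate_def saturate_def dmarked_enc dsubset_enc c)
qed (simp add: dsaturate_def saturate_def)

lemma ptime_dsaturate: "ptime u \<Longrightarrow> ptime v \<Longrightarrow> ptime (\<lambda>x. dsaturate (u x) (v x))"
  unfolding dsaturate_def
  by (rule ptime_dfold) (assumption | rule ptime_intros ptime_dsubset ptime_dmarked grows_additively_if grows_additively_right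
      grows_additively_DPair1)+

definition dweaken :: "data \<Rightarrow> data \<Rightarrow> data" where
  "dweaken = dfold (\<lambda>c. dsnd (dsnd c))
     (\<lambda>a b c s. DPair (DPair (dapp (DPair a b) (dfst c)) (DPair (dfst (dsnd c)) DNil)) (DPair s DNil))"

lemma enc_clause_sel:
  "dfst (enc_clause c) = enc_fms (body c)" "dfst (dsnd (enc_clause c)) = enc_fm (head c)"
  "dsnd (dsnd (enc_clause c)) = enc_ptree (certificate c)"
  by (simp_all add: enc_clause_def)

lemma dweaken_enc: "dweaken (enc_fms X) (enc_clause c) = enc_ptree (weaken X c)"
proof (induction X)
  case (Cons A X)
  have "dapp (DPair (enc_fm A) (enc_fms X)) (enc_fms (body c)) = enc_fms ((A # X) @ body c)"
    by (simp only: dapp_fms flip: enc_fms_simps)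
  then show ?case using Cons by (simp add: dweaken_def enc_clause_sel enc_wsequent)
qed (simp add: dweaken_def enc_clause_sel)

lemma ptime_dweaken: "ptime u \<Longrightarrow> ptime v \<Longrightarrow> ptime (\<lambda>x. dweaken (u x) (v x))"
  unfolding dweaken_def
  by (rule ptime_dfold) (assumption | rule ptime_intros ptime_dapp grows_additively_DPair1 grows_additively_DPair2
      grows_additively_right)+

text \<open>The case \<open>DNil\<close> makes \<open>size_dpush\<close> hold for every tree: two
  new pairs there would exceed the permitted growth of a parameter by one.\<close>

definition dpush :: "data \<Rightarrow> data \<Rightarrow> data" where
  "dpush a p = (if p = DNil then DNil else DPair (DPair a (dfst p)) (dsnd p))"

lemma dpush_DPair [simp]: "dpush a (DPair x y) = DPair (DPair a x) y"
  by (simp add: dpush_def)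

lemma size_dpush: "size (dpush a p) \<le> size a + size p + 1"
  by (cases p) (simp_all add: dpush_def)

lemma ptime_dpush: "ptime u \<Longrightarrow> ptime v \<Longrightarrow> ptime (\<lambda>x. dpush (u x) (v x))"
  unfolding dpush_def by (intro ptime_intros)

text \<open>The parameter packs \<open>Y\<close>, \<open>X\<close> and the clause, with the growing
  list in front, where \<open>dpush\<close> extends it.\<close>

definition dcontract :: "data \<Rightarrow> data \<Rightarrow> data" where
  "dcontract = drec (\<lambda>p. dweaken (dfst (dsnd p)) (dsnd (dsnd p)))
     (\<lambda>a b p r s. DPair (DPair (dapp (dfst p) (dfst (dsnd p)))
        (DPair (dfst (dsnd (dsnd (dsnd p)))) DNil)) (DPair s DNil))
     (\<lambda>a b p. DNil) (\<lambda>a b p. dpush a p)"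

lemma dcontract_enc:
  "dcontract (enc_fms Z) (DPair (enc_fms Y) (DPair (enc_fms X) (enc_clause c))) =
    enc_ptree (contract Z Y X c)"
proof (induction Z arbitrary: Y)
  case (Cons A Z)
  show ?case using Cons[of "A # Y"]
    by (simp add: dcontract_def enc_clause_sel enc_wsequent dapp_fms)
qed (simp add: dcontract_def dweaken_enc)

lemma ptime_dcontract: "ptime u \<Longrightarrow> ptime v \<Longrightarrow> ptime (\<lambda>x. dcontract (u x) (v x))"
  unfolding dcontract_def
  by (rule ptime_drec) (assumption | rule ptime_intros ptime_dapp ptime_dpush ptime_dweaken grows_additively_DPair1
      grows_additively_DPair2 grows_additively_right size_dpush | simp)+

definition dadapt :: "data \<Rightarrow> data \<Rightarrow> data" where
  "dadapt x c = dcontract (dfst c) (DPair DNil (DPair x c))"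

lemma dadapt_enc: "dadapt (enc_fms X) (enc_clause c) = enc_ptree (adapt X c)"
  using dcontract_enc[of "body c" "[]" X c] by (simp add: dadapt_def adapt_def enc_clause_sel)

lemma ptime_dadapt: "ptime u \<Longrightarrow> ptime v \<Longrightarrow> ptime (\<lambda>x. dadapt (u x) (v x))"
  unfolding dadapt_def by (intro ptime_intros ptime_dcontract)

definition dcuts :: "data \<Rightarrow> data \<Rightarrow> data" where
  "dcuts = drec
     (\<lambda>p. DPair (DPair (dmarked (dfst p) (dfst (dsnd p))) (DPair (dsnd (dsnd p)) DNil)) DNil)
     (\<lambda>a b p r s. DPair (DPair (dmarked (dfst p) (dfst (dsnd p))) (DPair (dsnd (dsnd p)) DNil))
        (DPair (dadapt (dmarked (dfst p) (dfst (dsnd p))) a) (DPair s DNil)))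
     (\<lambda>a b p. DNil) (\<lambda>a b p. dpush a p)"

lemma dcuts_enc:
  "dcuts (enc_clauses L) (DPair (enc_clauses s) (DPair (enc_fms \<Sigma>) (enc_fm F))) =
    enc_ptree (cuts L s \<Sigma> F)"
proof (induction L arbitrary: s)
  case (Cons c L)
  show ?case using Cons[of "c # s"]
    by (simp add: dcuts_def enc_wsequent dmarked_enc dadapt_enc)
qed (simp add: dcuts_def enc_wsequent dmarked_enc)

lemma ptime_dcuts: "ptime u \<Longrightarrow> ptime v \<Longrightarrow> ptime (\<lambda>x. dcuts (u x) (v x))"
  unfolding dcuts_def
  by (rule ptime_drec) (assumption | rule ptime_intros ptime_dmarked ptime_dpush ptime_dadapt grows_additively_DPair1
      grows_additively_DPair2 grows_additively_right size_dpush | simp)+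

definition dantecedents :: "data \<Rightarrow> data" where
  "dantecedents h = (if dfst h = enc_nat 5 then
     if dharrop h m_formula = DNil then DPair (dfst (dsnd h)) DNil else DNil else DNil)"

lemma dantecedents_enc: "dantecedents (enc_fm H) = enc_fms (antecedents H)"
  by (cases H) (simp_all add: dantecedents_def antecedents_def dharrop_enc del: enc_fm.simps,
    simp_all)

lemma ptime_dantecedents: "ptime u \<Longrightarrow> ptime (\<lambda>x. dantecedents (u x))"
  unfolding dantecedents_def by (intro ptime_intros ptime_dharrop)

definition ddrop :: "data \<Rightarrow> data \<Rightarrow> data" where
  "ddrop = dfold (\<lambda>p. DNil) (\<lambda>a b p s. if dmem a p = DNil then s else DPair a b)"

lemma ddrop_enc: "ddrop (enc_fms Fs) (enc_fms M) = enc_fms (dropWhile (\<lambda>F. F \<notin> set M) Fs)"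
  by (induction Fs) (simp_all add: ddrop_def dmem_enc)

lemma ptime_ddrop: "ptime u \<Longrightarrow> ptime v \<Longrightarrow> ptime (\<lambda>x. ddrop (u x) (v x))"
  unfolding ddrop_def
  by (rule ptime_dfold) (assumption | rule ptime_intros ptime_dmem grows_additively_if grows_additively_right grows_additively_pt)+

definition dfind :: "data \<Rightarrow> data \<Rightarrow> data \<Rightarrow> data \<Rightarrow> data" where
  "dfind s \<Sigma> Fs \<pi> = (if ddrop Fs (dmarked s \<Sigma>) = DNil then \<pi>
     else dcuts (drev s DNil) (DPair DNil (DPair \<Sigma> (dfst (ddrop Fs (dmarked s \<Sigma>))))))"

lemma dfind_enc:
  "dfind (enc_clauses s) (enc_fms \<Sigma>) (enc_fms Fs) (enc_ptree \<pi>) =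
    enc_ptree (find_proof s \<Sigma> Fs \<pi>)"
proof -
  have r: "drev (enc_clauses s) DNil = enc_clauses (rev s)"
    using drev_enc[of "map enc_clause s" "[]"] by (simp add: enc_clauses_def rev_map)
  show ?thesis
  proof (cases "dropWhile (\<lambda>F. F \<notin> set (marked s \<Sigma>)) Fs")
    case Nil
    then show ?thesis
      by (simp add: dfind_def find_proof_def dmarked_enc ddrop_enc del: dropWhile_eq_Nil_conv)
  next
    case (Cons F Gs)
    then show ?thesis using dcuts_enc[of "rev s" "[]" \<Sigma> F]
      by (simp add: dfind_def find_proof_def dmarked_enc ddrop_enc r)
  qed
qed

lemma ptime_dfind:
  "ptime a \<Longrightarrow> ptime b \<Longrightarrow> ptime c \<Longrightarrow> ptime d \<Longrightarrow> ptime (\<lambda>x. dfind (a x) (b x) (c x) (d x))"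
  unfolding dfind_def by (intro ptime_intros ptime_ddrop ptime_dmarked ptime_dcuts ptime_drev)

definition dsplit :: "(data \<Rightarrow> data \<Rightarrow> data) \<Rightarrow> data \<Rightarrow> data" where
  "dsplit F \<pi> = (if dfst (dfst (dsnd (dfst \<pi>))) = enc_nat 4 then
     if dsnd (dsnd (dfst \<pi>)) = DNil then
       dfind (dsaturate (dflat (\<lambda>c L. L) (dclauses F \<pi>) (dclauses F \<pi>)) (dfst (dfst \<pi>)))
         (dfst (dfst \<pi>))
         (DPair (dfst (dsnd (dfst (dsnd (dfst \<pi>)))))
            (DPair (dsnd (dsnd (dfst (dsnd (dfst \<pi>)))))
              (dflat (\<lambda>h p. dantecedents h) (dfst (dfst \<pi>)) DNil))) \<pi>
     else \<pi> else \<pi>)"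

lemma dsplit_enc:
  assumes "\<And>A B. F (enc_fm A) (enc_fm B) =
    enc_list (map enc_ptree (map (subst_wproof (pair_subst A B)) T))"
  shows "dsplit F (enc_ptree \<pi>) = enc_ptree (split_disjunction T \<pi>)"
proof -
  obtain \<Sigma> \<Delta> where S: "root_label \<pi> = (\<Sigma>, \<Delta>)" by (cases "root_label \<pi>")
  have [simp]: "dfst (enc_ptree \<pi>) = DPair (enc_fms \<Sigma>) (enc_fms \<Delta>)"
    using S by (cases \<pi>) (simp add: enc_wsequent)
  \<comment> \<open>On an empty succedent the projections in \<open>dsplit\<close> return
    \<open>DNil\<close>, which must not be taken for the tag of a disjunction.\<close>
  have tag: "DNil \<noteq> enc_nat 4" using enc_nat.simps[of 4] by simp
  let ?L = "clauses T \<pi>"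
  have rep: "dflat (\<lambda>c L. L) (enc_clauses ?L) (enc_clauses ?L) =
      enc_clauses (concat (map (\<lambda>_. ?L) ?L))"
    unfolding enc_clauses_def by (rule dflat_enc) simp
  have ants: "dflat (\<lambda>h p. dantecedents h) (enc_fms \<Sigma>) DNil =
      enc_fms (concat (map antecedents \<Sigma>))"
    unfolding enc_fms_def by (rule dflat_enc) (simp add: dantecedents_enc enc_fms_def)
  consider C D where "\<Delta> = [Or C D]" | "\<nexists>C D. \<Delta> = [Or C D]" by blast
  then show ?thesis
  proof cases
    case 1
    then show ?thesis
      using dfind_enc[of "saturate (concat (map (\<lambda>_. ?L) ?L)) \<Sigma>" \<Sigma>
          "C # D # concat (map antecedents \<Sigma>)" \<pi>]
      by (simp add: dsplit_def split_disjunction_def S dclauses_enc[OF assms] rep ants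
          dsaturate_enc Let_def)
  next
    case 2
    have "dsplit F (enc_ptree \<pi>) = enc_ptree \<pi>"
    proof (cases \<Delta>)
      case Nil
      then show ?thesis by (simp add: dsplit_def tag)
    next
      case (Cons G \<Delta>')
      then show ?thesis using 2 by (cases G; cases \<Delta>') (simp_all add: dsplit_def)
    qed
    moreover have "split_disjunction T \<pi> = \<pi>"
      using 2 unfolding split_disjunction_def S by (auto simp: Let_def split: list.splits fm.splits)
    ultimately show ?thesis by simp
  qed
qed

lemma ptime_dsplit:
  assumes "\<And>u v. ptime u \<Longrightarrow> ptime v \<Longrightarrow> ptime (\<lambda>x. F (u x) (v x))"
  shows "ptime (dsplit F)"
  unfolding dsplit_def[abs_def]
  by (intro ptime_intros ptime_dfind ptime_dsaturate ptime_dflat ptime_dclauses ptime_dantecedents assms)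

lemma poly_timeI:
  assumes "ptime F" "\<And>x. F (enc x) = enc' (f x)" shows "poly_time enc enc' f"
proof -
  obtain P e q where q: "poly_bounded q" and e: "\<And>x. eval_within P [x] e (F x) (q (size x))"
    using assms(1) unfolding ptime_def by blast
  obtain k where k: "\<And>n. q n \<le> (n + 2) ^ k" using q unfolding poly_bounded_def by blast
  \<comment> \<open>\<open>[:2, 1:]\<close> is the polynomial x + 2, so its k-th power is the bound
    found above.\<close>
  have "\<exists>t \<le> poly ([:2, 1:] ^ k) (size (enc x)). eval P [enc x] e (enc' (f x)) t" for x
    using eval_within_le[OF e k, of "enc x"] unfolding eval_within_def
    by (simp add: assms(2) poly_power add.commute)
  then show ?thesis unfolding poly_time_def by blast
qed

lemma poly_time_split_disjunction: "poly_time enc_ptree enc_ptree (split_disjunction T)"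
proof -
  obtain F where "\<And>u v. ptime u \<Longrightarrow> ptime v \<Longrightarrow> ptime (\<lambda>x. F (u x) (v x))"
    "\<And>A B. F (enc_fm A) (enc_fm B) =
      enc_list (map enc_ptree (map (subst_wproof (pair_subst A B)) T))"
    using template_wproofs[of T] unfolding template_def by blast
  then show ?thesis by (intro poly_timeI[of "dsplit F"] ptime_dsplit dsplit_enc)
qed

section \<open>Rule instances of CK\<close>

inductive step :: "fm set \<Rightarrow> sequent list \<Rightarrow> sequent \<Rightarrow> bool" for \<C> where
  Id: "step \<C> [] (add_mset p \<Gamma>, {#p#})"
| BotL: "size \<Delta> \<le> 1 \<Longrightarrow> step \<C> [] (add_mset Bot \<Gamma>, \<Delta>)"
| TopR: "step \<C> [] (\<Gamma>, {#Top#})"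
| WeakL: "size \<Delta> \<le> 1 \<Longrightarrow> step \<C> [(\<Gamma>, \<Delta>)] (add_mset p \<Gamma>, \<Delta>)"
| WeakR: "step \<C> [(\<Gamma>, {#})] (\<Gamma>, {#p#})"
| ContrL: "size \<Delta> \<le> 1 \<Longrightarrow> step \<C> [(add_mset p (add_mset p \<Gamma>), \<Delta>)] (add_mset p \<Gamma>, \<Delta>)"
| Cut: "size \<Delta> \<le> 1 \<Longrightarrow> step \<C> [(\<Gamma>, {#p#}), (add_mset p \<Gamma>, \<Delta>)] (\<Gamma>, \<Delta>)"
| AndL1: "size \<Delta> \<le> 1 \<Longrightarrow> step \<C> [(add_mset p \<Gamma>, \<Delta>)] (add_mset (And p q) \<Gamma>, \<Delta>)"
| AndL2: "size \<Delta> \<le> 1 \<Longrightarrow> step \<C> [(add_mset q \<Gamma>, \<Delta>)] (add_mset (And p q) \<Gamma>, \<Delta>)"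
| AndR: "step \<C> [(\<Gamma>, {#p#}), (\<Gamma>, {#q#})] (\<Gamma>, {#And p q#})"
| OrL: "size \<Delta> \<le> 1 \<Longrightarrow> step \<C> [(add_mset p \<Gamma>, \<Delta>), (add_mset q \<Gamma>, \<Delta>)] (add_mset (Or p q) \<Gamma>, \<Delta>)"
| OrR1: "step \<C> [(\<Gamma>, {#p#})] (\<Gamma>, {#Or p q#})"
| OrR2: "step \<C> [(\<Gamma>, {#q#})] (\<Gamma>, {#Or p q#})"
| ImpL: "size \<Delta> \<le> 1 \<Longrightarrow> step \<C> [(\<Gamma>, {#p#}), (add_mset q \<Gamma>, \<Delta>)] (add_mset (Imp p q) \<Gamma>, \<Delta>)"
| ImpR: "step \<C> [(add_mset p \<Gamma>, {#q#})] (\<Gamma>, {#Imp p q#})"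
| BoxK: "step \<C> [(\<Gamma>, {#p#})] (image_mset Box \<Gamma>, {#Box p#})"
| DiaK: "step \<C> [(add_mset p \<Gamma>, {#q#})] (add_mset (Dia p) (image_mset Box \<Gamma>), {#Dia q#})"
| Ax: "C \<in> \<C> \<Longrightarrow> step \<C> [] ({#}, {#fm_subst \<sigma> C#})"

lemma CK_step:
  "\<forall>r \<in> CK. (\<forall>S \<in> set (snd r # fst r). single_conclusion (inst \<sigma> \<tau> S)) \<longrightarrow>
     step \<C> (map (inst \<sigma> \<tau>) (fst r)) (inst \<sigma> \<tau> (snd r))"
  unfolding CK_def LJ_def Let_def
  by (simp add: inst_def single_conclusion_def step.intros)

definition rule_step :: "calculus \<Rightarrow> sequent list \<Rightarrow> sequent \<Rightarrow> bool" where
  "rule_step G Ps S \<longleftrightarrow> (\<exists>r \<in> G. (Ps, S) \<in> rule_instances r)"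

text \<open>The rules of \<open>CK\<close> are all written with schematic atoms 0 and 1 and multiset
  variables 0 and 1, so one substitution and one assignment serve every rule at once.\<close>

lemma rule_step_CK:
  fixes \<Gamma> \<Delta> :: "fm multiset"
  defines "\<tau> \<equiv> \<lambda>i :: nat. if i = 0 then \<Gamma> else \<Delta>"
  assumes "CK \<subseteq> G" and d: "size \<Delta> \<le> 1"
  shows "\<forall>r \<in> CK. rule_step G
    (map (inst (pair_subst p q) \<tau>) (fst r)) (inst (pair_subst p q) \<tau> (snd r))"
proof
  fix r assume r: "r \<in> CK"
  have "\<forall>r \<in> CK. \<forall>S \<in> set (snd r # fst r). single_conclusion (inst (pair_subst p q) \<tau> S)"
    using d unfolding CK_def LJ_def Let_def by (simp add: inst_def single_conclusion_def \<tau>_def)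
  then have "(map (inst (pair_subst p q) \<tau>) (fst r), inst (pair_subst p q) \<tau> (snd r)) \<in> rule_instances r"
    using r unfolding rule_instances_def by blast
  then show "rule_step G
      (map (inst (pair_subst p q) \<tau>) (fst r)) (inst (pair_subst p q) \<tau> (snd r))"
    using r assms(2) unfolding rule_step_def by blast
qed

lemma step_iff: "rule_step (add_axioms CK \<C>) Ps S \<longleftrightarrow> step \<C> Ps S"
proof
  assume "rule_step (add_axioms CK \<C>) Ps S"
  then obtain r \<sigma> \<tau> where r: "r \<in> add_axioms CK \<C>"
    and S: "Ps = map (inst \<sigma> \<tau>) (fst r)" "S = inst \<sigma> \<tau> (snd r)"
    and sc: "\<forall>S \<in> set (snd r # fst r). single_conclusion (inst \<sigma> \<tau> S)"
    unfolding rule_step_def rule_instances_def by blast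
  show "step \<C> Ps S"
  proof (cases "r \<in> CK")
    case True
    then show ?thesis using CK_step sc S by blast
  next
    case False
    then show ?thesis using r S by (auto simp: add_axioms_def inst_def intro: Ax)
  qed
next
  have CK: "CK \<subseteq> add_axioms CK \<C>" by (auto simp: add_axioms_def)
  define G where "G = add_axioms CK \<C>"
  note R = rule_step_CK[of G, unfolded G_def, OF CK, folded G_def, unfolded CK_def LJ_def Let_def]
  assume "step \<C> Ps S"
  then have "rule_step G Ps S"
  proof cases
    case (Ax C \<sigma>)
    have "([], ({#}, {#fm_subst \<sigma> C#})) \<in> rule_instances ([], ([], [Fm C]))"
      unfolding rule_instances_def by (auto simp: inst_def single_conclusion_def)
    then show ?thesis using Ax unfolding G_def add_axioms_def rule_step_def by blast
  \<comment> \<open>Rules with a fixed succedent do not determine \<open>\<Delta>\<close>; the empty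
    multiset is taken for it.\<close>
  qed (use R R[where \<Delta> = "{#}"] in \<open>simp add: inst_def pair_subst_def\<close>)+
  then show "rule_step (add_axioms CK \<C>) Ps S" unfolding G_def .
qed

section \<open>Correctness of the constructed proofs\<close>

abbreviation wproves :: "calculus \<Rightarrow> fm list \<Rightarrow> fm list \<Rightarrow> wproof \<Rightarrow> bool" where
  "wproves G X Y t \<equiv> written_proof G {} (mset X, mset Y) t"

text \<open>Without assumptions every node is an inference, so \<open>step_iff\<close> turns the
  definition into a check node by node.\<close>

lemma written_proof_Node:
  "written_proof (add_axioms CK \<C>) {} S (Node R ts) \<longleftrightarrow> S = sequent_of R \<and>
     step \<C> (map (\<lambda>t. sequent_of (root_label t)) ts) (sequent_of R) \<and>
     (\<forall>t \<in> set ts. written_proof (add_axioms CK \<C>) {} (sequent_of (root_label t)) t)"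
proof -
  have root: "root_label (map_ptree f t) = f (root_label t)" for f :: "wsequent \<Rightarrow> sequent" and t
    by (cases t) simp
  have "proof_from (add_axioms CK \<C>) {} (Node R' ts') \<longleftrightarrow>
      rule_step (add_axioms CK \<C>) (map root_label ts') R' \<and>
      (\<forall>t \<in> set ts'. proof_from (add_axioms CK \<C>) {} t)" for R' ts'
    unfolding rule_step_def by (subst proof_from.simps) auto
  then show ?thesis by (auto simp: written_proof_def step_iff root comp_def)
qed

lemma written_proof_root: "written_proof G {} S t \<Longrightarrow> sequent_of (root_label t) = S"
  by (cases t) (simp add: written_proof_def)

lemma written_proof_NodeI:
  assumes "step \<C> Ps S" "sequent_of R = S"
    "list_all2 (written_proof (add_axioms CK \<C>) {}) Ps ts"
  shows "written_proof (add_axioms CK \<C>) {} S (Node R ts)"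
proof -
  have "map (\<lambda>t. sequent_of (root_label t)) ts = Ps"
    using assms(3) by (induction rule: list_all2_induct) (auto dest: written_proof_root)
  moreover have "written_proof (add_axioms CK \<C>) {} (sequent_of (root_label t)) t" if "t \<in> set ts" for t
    using assms(3) that written_proof_root by (metis in_set_conv_nth list_all2_conv_all_nth)
  ultimately show ?thesis using assms(1,2) by (simp add: written_proof_Node)
qed

lemma step_single_conclusion: "step \<C> Ps S \<Longrightarrow> size (snd S) \<le> 1"
  by (cases rule: step.cases) auto

lemma written_proof_single_conclusion:
  assumes "written_proof (add_axioms CK \<C>) {} S t" shows "size (snd S) \<le> 1"
  using assms by (cases t) (auto simp: written_proof_Node dest: step_single_conclusion)

lemma written_proof_subproofs:
  "written_proof (add_axioms CK \<C>) {} S \<pi> \<Longrightarrow> t \<in> set (subproofs \<pi>) \<Longrightarrow>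
    written_proof (add_axioms CK \<C>) {} (sequent_of (root_label t)) t"
proof (induction \<pi> arbitrary: S)
  case (Node R ts)
  show ?case
  proof (cases "t = Node R ts")
    case True
    then show ?thesis using Node.prems(1) written_proof_root by metis
  next
    case False
    then obtain u where u: "u \<in> set ts" "t \<in> set (subproofs u)" using Node.prems(2) by auto
    then have "written_proof (add_axioms CK \<C>) {} (sequent_of (root_label u)) u"
      using Node.prems(1) by (simp add: written_proof_Node)
    then show ?thesis using Node.IH u by blast
  qed
qed

section \<open>Certified clauses and the chain of cuts\<close>

definition certified :: "calculus \<Rightarrow> clause \<Rightarrow> bool" where
  "certified G c \<longleftrightarrow> wproves G (body c) [head c] (certificate c)"

lemma certified_mk_clause:
  assumes "written_proof (add_axioms CK \<C>) {} S t"
  shows "certified (add_axioms CK \<C>) (mk_clause t)"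
proof (cases "snd (root_label t)")
  case Nil
  have "S = (mset (fst (root_label t)), {#})"
    using written_proof_root[OF assms] Nil by (simp add: sequent_of_def)
  then have "written_proof (add_axioms CK \<C>) {} (mset (fst (root_label t)), {#Bot#})
      (Node (fst (root_label t), [Bot]) [t])"
    using assms by (intro written_proof_NodeI[OF step.WeakR]) (auto simp: sequent_of_def)
  then show ?thesis using Nil by (simp add: certified_def mk_clause_def Let_def)
next
  case (Cons F Y)
  have "S = (mset (fst (root_label t)), mset (F # Y))"
    using written_proof_root[OF assms] Cons by (simp add: sequent_of_def)
  moreover have "Y = []" using written_proof_single_conclusion[OF assms] calculation by simp
  ultimately show ?thesis using Cons assms by (simp add: certified_def mk_clause_def Let_def)
qed

lemma weaken_proof:
  assumes "certified (add_axioms CK \<C>) c"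
  shows "wproves (add_axioms CK \<C>) (X @ body c) [head c] (weaken X c)"
proof (induction X)
  case (Cons A X)
  have "step \<C> [(mset (X @ body c), mset [head c])] (add_mset A (mset (X @ body c)), mset [head c])"
    by (rule step.WeakL) simp
  from written_proof_NodeI[OF this] Cons show ?case by (simp add: sequent_of_def)
qed (use assms in \<open>simp add: certified_def\<close>)

text \<open>Above all contractions the antecedent consists of \<open>X\<close> and the whole body.
  Each contraction merges one body formula with its copy in \<open>X\<close>.\<close>

lemma contract_proof:
  assumes "certified (add_axioms CK \<C>) c" "set Z \<subseteq> set X" "mset Y + mset Z = mset (body c)"
  shows "wproves (add_axioms CK \<C>) (Y @ X) [head c] (contract Z Y X c)"
  using assms(2,3)
proof (induction Z arbitrary: Y)
  case Nil
  then show ?case using weaken_proof[OF assms(1), of X] by (simp add: add.commute)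
next
  case (Cons A Z)
  have IH: "wproves (add_axioms CK \<C>) ((A # Y) @ X) [head c] (contract Z (A # Y) X c)"
    using Cons.IH[of "A # Y"] Cons.prems by simp
  obtain M where M: "mset X = add_mset A M"
    using Cons.prems(1) mset_add[of A "mset X"] by auto
  have "step \<C> [(add_mset A (add_mset A (mset Y + M)), mset [head c])]
      (add_mset A (mset Y + M), mset [head c])"
    by (rule step.ContrL) simp
  from written_proof_NodeI[OF this] IH show ?case by (simp add: sequent_of_def M)
qed

lemma adapt_proof:
  assumes "certified (add_axioms CK \<C>) c" "set (body c) \<subseteq> set X"
  shows "wproves (add_axioms CK \<C>) X [head c] (adapt X c)"
  using contract_proof[OF assms, of "[]"] by (simp add: adapt_def)

primrec justified :: "calculus \<Rightarrow> fm list \<Rightarrow> clause list \<Rightarrow> bool" where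
  "justified G \<Sigma> [] = True"
| "justified G \<Sigma> (c # s) =
    (certified G c \<and> set (body c) \<subseteq> set (marked s \<Sigma>) \<and> justified G \<Sigma> s)"

lemma justified_append: "justified G \<Sigma> (s @ s') \<Longrightarrow> justified G \<Sigma> s'"
  by (induction s) simp_all

lemma marked_simps [simp]: "marked [] \<Sigma> = \<Sigma>" "marked (c # s) \<Sigma> = head c # marked s \<Sigma>"
  by (simp_all add: marked_def)

text \<open>\<open>L\<close> holds the clauses still to be cut in, oldest first, and
  \<open>s\<close> those already used, so \<open>rev L @ s\<close> stays the same list all along the
  spine.\<close>

lemma cuts_proof:
  assumes "justified (add_axioms CK \<C>) \<Sigma> (rev L @ s)" "F \<in> set (marked (rev L @ s) \<Sigma>)"
  shows "wproves (add_axioms CK \<C>) (marked s \<Sigma>) [F] (cuts L s \<Sigma> F)"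
  using assms
proof (induction L arbitrary: s)
  case Nil
  then obtain M where M: "mset (marked s \<Sigma>) = add_mset F M"
    using mset_add[of F "mset (marked s \<Sigma>)"] by auto
  from written_proof_NodeI[OF step.Id[of \<C> F M]] show ?case by (simp add: sequent_of_def M)
next
  case (Cons c L)
  have IH: "wproves (add_axioms CK \<C>) (marked (c # s) \<Sigma>) [F] (cuts L (c # s) \<Sigma> F)"
    using Cons.IH[of "c # s"] Cons.prems by simp
  have "justified (add_axioms CK \<C>) \<Sigma> (c # s)"
    using justified_append[of _ _ "rev L" "c # s"] Cons.prems(1) by simp
  then have a: "wproves (add_axioms CK \<C>) (marked s \<Sigma>) [head c] (adapt (marked s \<Sigma>) c)"
    by (intro adapt_proof) simp_all
  have "step \<C> [(mset (marked s \<Sigma>), {#head c#}), (add_mset (head c) (mset (marked s \<Sigma>)), mset [F])]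
      (mset (marked s \<Sigma>), mset [F])"
    by (rule step.Cut) simp
  from written_proof_NodeI[OF this] IH a show ?case by (simp add: sequent_of_def)
qed

section \<open>Saturation\<close>

abbreviation saturate_from :: "fm list \<Rightarrow> clause list \<Rightarrow> clause list \<Rightarrow> clause list" where
  "saturate_from \<Sigma> \<equiv> foldr (\<lambda>c s. if set (body c) \<subseteq> set (marked s \<Sigma>) then c # s else s)"

lemma saturate_justified:
  "(\<And>c. c \<in> set L \<Longrightarrow> certified G c) \<Longrightarrow> justified G \<Sigma> (saturate L \<Sigma>)"
  by (induction L) (simp_all add: saturate_def)

definition closed_under :: "clause list \<Rightarrow> fm set \<Rightarrow> bool" where
  "closed_under L M \<longleftrightarrow> (\<forall>c \<in> set L. set (body c) \<subseteq> M \<longrightarrow> head c \<in> M)"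

lemma saturate_from_mono: "set (marked s \<Sigma>) \<subseteq> set (marked (saturate_from \<Sigma> L s) \<Sigma>)"
  by (induction L) auto

lemma saturate_from_head:
  assumes "c \<in> set L" "set (body c) \<subseteq> set (marked s \<Sigma>)"
  shows "head c \<in> set (marked (saturate_from \<Sigma> L s) \<Sigma>)"
  using assms(1)
proof (induction L)
  case (Cons d L)
  then show ?case using saturate_from_mono[of s \<Sigma> L] assms(2) by auto
qed simp

lemma saturate_from_closed:
  assumes "closed_under L (set (marked s \<Sigma>))" "set L' \<subseteq> set L"
  shows "set (marked (saturate_from \<Sigma> L' s) \<Sigma>) = set (marked s \<Sigma>)"
  using assms(2)
proof (induction L')
  case (Cons c L')
  then show ?case using assms(1) unfolding closed_under_def by auto
qed simp

text \<open>Each round over \<open>L\<close> that does not reach a closed set marks a new head, so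
  \<open>length L\<close> rounds suffice.\<close>

lemma saturate_closed: "closed_under L (set (marked (saturate (concat (map (\<lambda>_. L) L)) \<Sigma>) \<Sigma>))"
proof -
  define H where "H = (\<lambda>c. head c) ` set L"
  define s where "s k = saturate_from \<Sigma> (concat (replicate k L)) []" for k
  have rounds: "s (Suc k) = saturate_from \<Sigma> L (s k)" for k by (simp add: s_def)
  let ?M = "\<lambda>k. set (marked (s k) \<Sigma>)"
  have fin: "finite H" by (simp add: H_def)
  have "closed_under L (?M k) \<or> k \<le> card (?M k \<inter> H)" for k
  proof (induction k)
    case (Suc k)
    show ?case
    proof (cases "closed_under L (?M k)")
      case True
      then show ?thesis using saturate_from_closed[of L "s k" \<Sigma> L] by (simp add: rounds)
    next
      case False
      then obtain c where c: "c \<in> set L" "set (body c) \<subseteq> ?M k" "head c \<notin> ?M k"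
        unfolding closed_under_def by blast
      have "head c \<in> ?M (Suc k) \<inter> H" "?M k \<subseteq> ?M (Suc k)"
        using saturate_from_head[OF c(1,2)] saturate_from_mono[of "s k" \<Sigma> L] c(1)
        by (auto simp: rounds H_def)
      then have "?M k \<inter> H \<subset> ?M (Suc k) \<inter> H" using c(3) by blast
      then have "card (?M k \<inter> H) < card (?M (Suc k) \<inter> H)"
        using fin by (intro psubset_card_mono) auto
      then show ?thesis using Suc.IH False by simp
    qed
  qed simp
  then have "closed_under L (?M (length L)) \<or> length L \<le> card (?M (length L) \<inter> H)" .
  moreover have "closed_under L (?M (length L))" if "length L \<le> card (?M (length L) \<inter> H)"
  proof -
    have "card H \<le> length L" unfolding H_def by (meson card_image_le card_length finite_set le_trans)
    then have "?M (length L) \<inter> H = H" using that fin by (intro card_seteq) auto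
    then show ?thesis unfolding closed_under_def H_def by blast
  qed
  ultimately show ?thesis by (auto simp: s_def saturate_def map_replicate_const)
qed

text \<open>Rules are schematic, so a further substitution is composed with the one of the instance;
  in the modal rules it commutes with \<open>Box\<close>.\<close>

lemma step_subst:
  assumes "step \<C> Ps S"
  shows "step \<C> (map (map_prod (image_mset (fm_subst \<sigma>)) (image_mset (fm_subst \<sigma>))) Ps)
    (map_prod (image_mset (fm_subst \<sigma>)) (image_mset (fm_subst \<sigma>)) S)"
proof -
  have ss: "fm_subst \<sigma> (fm_subst \<sigma>' A) = fm_subst (\<lambda>n. fm_subst \<sigma> (\<sigma>' n)) A" for \<sigma>' A
    by (induction A) simp_all
  have box: "image_mset (fm_subst \<sigma>) (image_mset Box \<Gamma>) = image_mset Box (image_mset (fm_subst \<sigma>) \<Gamma>)"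
    for \<Gamma> by (simp add: multiset.map_comp comp_def)
  show ?thesis using assms
    by cases (simp_all add: box step.intros ss del: multiset.map_comp image_mset.compositionality)
qed

lemma written_proof_subst:
  "written_proof (add_axioms CK \<C>) {} (sequent_of (root_label t)) t \<Longrightarrow>
   written_proof (add_axioms CK \<C>) {} (sequent_of (root_label (subst_wproof \<sigma> t))) (subst_wproof \<sigma> t)"
proof (induction t)
  case (Node R ts)
  have root: "root_label (subst_wproof \<sigma> t) =
      map_prod (map (fm_subst \<sigma>)) (map (fm_subst \<sigma>)) (root_label t)" for t
    by (cases t) (simp add: subst_wproof_def)
  have seq: "sequent_of (map_prod (map f) (map f) S) =
      map_prod (image_mset f) (image_mset f) (sequent_of S)" for f S
    by (simp add: sequent_of_def map_prod_def split_beta)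
  have "step \<C> (map (\<lambda>t. sequent_of (root_label t)) (map (subst_wproof \<sigma>) ts))
      (sequent_of (map_prod (map (fm_subst \<sigma>)) (map (fm_subst \<sigma>)) R))"
    using step_subst[of \<C> "map (\<lambda>t. sequent_of (root_label t)) ts" "sequent_of R" \<sigma>] Node.prems
    by (simp add: written_proof_Node root seq comp_def)
  moreover have "subst_wproof \<sigma> (Node R ts) =
      Node (map_prod (map (fm_subst \<sigma>)) (map (fm_subst \<sigma>)) R) (map (subst_wproof \<sigma>) ts)"
    by (simp add: subst_wproof_def)
  ultimately show ?case using Node by (simp add: written_proof_Node)
qed

lemma surj_sequent_of: "surj sequent_of"
proof (rule surjI)
  show "sequent_of (SOME X. mset X = fst S, SOME Y. mset Y = snd S) = S" for S
    using someI_ex[OF ex_mset[of "fst S"]] someI_ex[OF ex_mset[of "snd S"]]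
    by (simp add: sequent_of_def)
qed

text \<open>From left to right, every label is replaced by a chosen enumeration of its two
  multisets.\<close>

lemma provable_written_proof: "provable G S \<longleftrightarrow> (\<exists>t. written_proof G {} S t)"
proof
  assume "provable G S"
  then obtain \<pi> where \<pi>: "proof_from G {} \<pi>" "root_label \<pi> = S" unfolding provable_def by blast
  have "map_ptree sequent_of (map_ptree (inv sequent_of) \<pi>) = map_ptree id \<pi>"
    unfolding ptree.map_comp using surj_iff[THEN iffD1, OF surj_sequent_of] by simp
  then have "written_proof G {} S (map_ptree (inv sequent_of) \<pi>)"
    using \<pi> by (simp add: written_proof_def ptree.map_id)
  then show "\<exists>t. written_proof G {} S t" by blast
next
  assume "\<exists>t. written_proof G {} S t"
  then show "provable G S" unfolding provable_def written_proof_def by blast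
qed

lemma provable_step:
  assumes "step \<C> Ps S" "\<forall>P \<in> set Ps. provable (add_axioms CK \<C>) P"
  shows "provable (add_axioms CK \<C>) S"
proof -
  obtain R where R: "sequent_of R = S" using surj_sequent_of by (metis surjD)
  have "\<exists>ts. list_all2 (written_proof (add_axioms CK \<C>) {}) Ps ts"
    using assms(2) by (induction Ps) (auto simp: provable_written_proof list_all2_Cons1)
  then show ?thesis using written_proof_NodeI[OF assms(1) R] provable_written_proof by blast
qed

section \<open>The slash over a saturated set\<close>

text \<open>The modal clauses copy the one-node frames: in the \<open>T\<close>-free case, a diamond is never
  slashed, and a box is slashed as soon as it is marked.\<close>

primrec slashed :: "bool \<Rightarrow> fm set \<Rightarrow> fm \<Rightarrow> bool" where
  "slashed full M (Atom n) = (Atom n \<in> M)"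
| "slashed full M Top = True"
| "slashed full M Bot = False"
| "slashed full M (And A B) = (slashed full M A \<and> slashed full M B)"
| "slashed full M (Or A B) = (slashed full M A \<or> slashed full M B)"
| "slashed full M (Imp A B) = (Imp A B \<in> M \<and> (slashed full M A \<longrightarrow> slashed full M B))"
| "slashed full M (Box A) = (Box A \<in> M \<and> (full \<longrightarrow> slashed full M A))"
| "slashed full M (Dia A) = (full \<and> slashed full M A)"

abbreviation p0 :: fm where "p0 \<equiv> Atom 0"
abbreviation p1 :: fm where "p1 \<equiv> Atom 1"

text \<open>These are the closure properties of provability that the slash argument asks of
  \<open>M\<close> for all formulas of the proof. New implications and boxes are marked through the
  sequents of the proof itself. By the second rule a marked \<open>Bot\<close> would mark every
  formula of the proof.\<close>

definition horn_rules :: "bool \<Rightarrow> (fm list \<times> fm) list" where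
  "horn_rules full = [([], Top), ([Bot], p0), ([p0, p1], And p0 p1), ([And p0 p1], p0),
     ([And p0 p1], p1), ([p0], Or p0 p1), ([p1], Or p0 p1), ([Imp p0 p1, p0], p1)]
     @ (if full then [([Box p0], p0), ([p0], Dia p0)] else [])"

definition node_frame :: "bool \<Rightarrow> frame" where
  "node_frame full = (if full then Reflexive_node else Irreflexive_node)"

lemma set_subformulas_self: "A \<in> set (subformulas A)"
  by (cases A) simp_all

lemma subformulas_trans: "A \<in> set (subformulas B) \<Longrightarrow> set (subformulas A) \<subseteq> set (subformulas B)"
  by (induction B) auto

text \<open>\<open>S\<close> stands for the formulas of the input proof and \<open>M\<close> for the
  marked ones. The algorithm instantiates Horn rules only at formulas of \<open>S\<close>; since
  \<open>S\<close> is not empty, there is an instance that marks \<open>Top\<close>.\<close>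

locale saturated =
  fixes full :: bool and M S :: "fm set"
  assumes sub: "A \<in> S \<Longrightarrow> set (subformulas A) \<subseteq> S"
    and closed: "(X, F) \<in> set (horn_rules full) \<Longrightarrow> A \<in> S \<Longrightarrow> B \<in> S \<Longrightarrow>
      fm_subst (pair_subst A B) ` set X \<subseteq> M \<Longrightarrow> fm_subst (pair_subst A B) F \<in> M"
    and S_nonempty: "S \<noteq> {}"
    and Bot: "Bot \<notin> M"
begin

abbreviation slash :: "fm \<Rightarrow> bool" where "slash \<equiv> slashed full M"

lemma S_simps:
  "And A B \<in> S \<Longrightarrow> A \<in> S \<and> B \<in> S" "Or A B \<in> S \<Longrightarrow> A \<in> S \<and> B \<in> S"
  "Imp A B \<in> S \<Longrightarrow> A \<in> S \<and> B \<in> S" "Box A \<in> S \<Longrightarrow> A \<in> S" "Dia A \<in> S \<Longrightarrow> A \<in> S"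
  by (drule sub, simp, use set_subformulas_self in blast)+

lemma closed_simps:
  assumes "A \<in> S" "B \<in> S"
  shows "Top \<in> M"
    and "A \<in> M \<Longrightarrow> B \<in> M \<Longrightarrow> And A B \<in> M"
    and "And A B \<in> M \<Longrightarrow> A \<in> M"
    and "And A B \<in> M \<Longrightarrow> B \<in> M"
    and "A \<in> M \<Longrightarrow> Or A B \<in> M"
    and "B \<in> M \<Longrightarrow> Or A B \<in> M"
    and "Imp A B \<in> M \<Longrightarrow> A \<in> M \<Longrightarrow> B \<in> M"
    and "full \<Longrightarrow> Box A \<in> M \<Longrightarrow> A \<in> M"
    and "full \<Longrightarrow> A \<in> M \<Longrightarrow> Dia A \<in> M"
  subgoal using closed[of "[]" "Top", OF _ assms] by (simp add: horn_rules_def pair_subst_def)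
  subgoal using closed[of "[p0, p1]" "And p0 p1", OF _ assms] by (simp add: horn_rules_def pair_subst_def)
  subgoal using closed[of "[And p0 p1]" "p0", OF _ assms] by (simp add: horn_rules_def pair_subst_def)
  subgoal using closed[of "[And p0 p1]" "p1", OF _ assms] by (simp add: horn_rules_def pair_subst_def)
  subgoal using closed[of "[p0]" "Or p0 p1", OF _ assms] by (simp add: horn_rules_def pair_subst_def)
  subgoal using closed[of "[p1]" "Or p0 p1", OF _ assms] by (simp add: horn_rules_def pair_subst_def)
  subgoal using closed[of "[Imp p0 p1, p0]" "p1", OF _ assms] by (simp add: horn_rules_def pair_subst_def)
  subgoal using closed[of "[Box p0]" "p0", OF _ assms] by (simp add: horn_rules_def pair_subst_def)
  subgoal using closed[of "[p0]" "Dia p0", OF _ assms] by (simp add: horn_rules_def pair_subst_def)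
  done

lemma Top_closed: "Top \<in> M"
proof -
  obtain A where "A \<in> S" using S_nonempty by blast
  then show ?thesis using closed_simps(1)[of A A] by blast
qed

lemma And_closed: "A \<in> S \<Longrightarrow> B \<in> S \<Longrightarrow> And A B \<in> M \<longleftrightarrow> A \<in> M \<and> B \<in> M"
  using closed_simps(2-4)[of A B] by blast

lemma Or_closed: "A \<in> S \<Longrightarrow> B \<in> S \<Longrightarrow> A \<in> M \<or> B \<in> M \<Longrightarrow> Or A B \<in> M"
  using closed_simps(5,6)[of A B] by blast

lemmas Imp_closed = closed_simps(7) and Box_closed = closed_simps(8) and Dia_closed = closed_simps(9)

text \<open>Membership is built into the slash of atoms, implications and boxes. The other
  connectives are handled by the Horn rules, except that in the \<open>T\<close>-free case no
  diamond is slashed.\<close>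

lemma slash_mem: "A \<in> S \<Longrightarrow> slash A \<Longrightarrow> A \<in> M"
proof (induction A)
  case (And A B)
  then show ?case using S_simps(1)[of A B] And_closed[of A B] by simp
next
  case (Or A B)
  then show ?case using S_simps(2)[of A B] Or_closed[of A B] by auto
next
  case (Dia A)
  then show ?case using S_simps(5)[of A] Dia_closed[of A A] by (cases full) simp_all
qed (simp_all add: Top_closed)

text \<open>Marked Harrop formulas can be taken apart inside \<open>M\<close>. A slashed antecedent
  of an implication is marked by \<open>slash_mem\<close>, so modus ponens marks the consequent,
  whatever shape the antecedent has.\<close>

lemma slash_harrop: "harrop A \<Longrightarrow> A \<in> S \<Longrightarrow> A \<in> M \<Longrightarrow> slash A"
proof (induction rule: harrop.induct)
  case (4 A B)
  then show ?case using S_simps(1)[of A B] And_closed[of A B] by simp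
next
  case (5 A)
  then show ?case using S_simps(4)[of A] Box_closed[of A A] by (cases full) simp_all
next
  case (6 B A)
  then show ?case using S_simps(3)[of A B] Imp_closed[of A B] slash_mem[of A] by auto
qed (simp_all add: Bot)

context
  fixes \<sigma> :: "nat \<Rightarrow> fm"
begin

abbreviation node_true :: "fm \<Rightarrow> bool" where "node_true \<equiv> holds (node_frame full) {n. slash (\<sigma> n)}"

text \<open>Without implications and boxes the slash imposes membership only on atoms, and its
  clauses are those of truth at the node.\<close>

lemma slash_basic: "basic A \<Longrightarrow> slash (fm_subst \<sigma> A) \<longleftrightarrow> node_true A"
  by (induction rule: basic.induct) (simp_all add: node_frame_def)

text \<open>Dropping the membership conditions leaves one direction. It survives an implication
  because the antecedent is basic and \<open>slash_basic\<close> is an equivalence.\<close>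

lemma slash_almost_positive: "almost_positive A \<Longrightarrow> slash (fm_subst \<sigma> A) \<Longrightarrow> node_true A"
  by (induction rule: almost_positive.induct) (auto simp: node_frame_def slash_basic split: if_splits)

text \<open>The slash asks for membership and a semantic part, and both descend together. At an
  implication a slashed antecedent is marked as well as true, the latter by almost positivity; so
  the consequent is marked and true.\<close>

lemma slash_constructive:
  "constructive A \<Longrightarrow> node_true A \<Longrightarrow> fm_subst \<sigma> A \<in> S \<Longrightarrow> fm_subst \<sigma> A \<in> M \<Longrightarrow> slash (fm_subst \<sigma> A)"
proof (induction rule: constructive.induct)
  case (1 A)
  then show ?case by (simp add: slash_basic)
next
  case (2 A B)
  then show ?case
    using S_simps(1)[of "fm_subst \<sigma> A" "fm_subst \<sigma> B"]
      And_closed[of "fm_subst \<sigma> A" "fm_subst \<sigma> B"] by simp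
next
  case (3 A)
  then show ?case
    using S_simps(4)[of "fm_subst \<sigma> A"] Box_closed[of "fm_subst \<sigma> A" "fm_subst \<sigma> A"]
    by (simp add: node_frame_def split: if_splits)
next
  case (4 A B)
  let ?A = "fm_subst \<sigma> A" and ?B = "fm_subst \<sigma> B"
  have "slash ?B" if "slash ?A"
  proof -
    have S: "?A \<in> S" "?B \<in> S" using 4 S_simps(3)[of ?A ?B] by simp_all
    have "?B \<in> M" using 4 Imp_closed[OF S] slash_mem[OF S(1) that] by simp
    moreover have "node_true B" using 4 slash_almost_positive that by simp
    ultimately show ?thesis using 4 S by blast
  qed
  then show ?case using 4 by simp
qed

end

definition sound :: "sequent \<Rightarrow> bool" where
  "sound R \<longleftrightarrow> ((\<forall>A \<in># fst R. slash A) \<longrightarrow> (\<exists>F \<in># snd R. slash F))"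

lemma step_sound:
  assumes "step \<C> Ps R" "\<forall>P \<in> set Ps. sound P"
    and ax: "\<And>C V. C \<in> \<C> \<Longrightarrow> constructive C \<and> holds (node_frame full) V C"
    and S: "set_mset (snd R) \<subseteq> S"
    and M: "(\<forall>A \<in># fst R. slash A) \<Longrightarrow> set_mset (snd R) \<subseteq> M"
  shows "sound R"
  using assms(1)
proof cases
  case (Ax C \<sigma>)
  then show ?thesis using slash_constructive[of C \<sigma>] ax S M by (simp add: sound_def)
next
  case (BoxK \<Gamma> p)
  \<comment> \<open>In the \<open>T\<close>-free case the diamond on the left is not slashed. In the
    \<open>T\<close>-full case slashed boxes have slashed bodies, and the premise applies.\<close>
  then show ?thesis using assms(2) M by (auto simp: sound_def)
next
  case (DiaK p \<Gamma> q)
  then show ?thesis using assms(2) by (auto simp: sound_def)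
next
  case (ImpR p \<Gamma> q)
  then show ?thesis using assms(2) M by (auto simp: sound_def)
qed (use assms(2) in \<open>auto simp: sound_def\<close>)

lemma written_proof_sound:
  assumes "written_proof (add_axioms CK \<C>) {} R \<pi>" "set (formulas \<pi>) \<subseteq> S"
    and ax: "\<And>C V. C \<in> \<C> \<Longrightarrow> constructive C \<and> holds (node_frame full) V C"
    and "closed_under (map mk_clause (subproofs \<pi>)) M"
  shows "sound R"
  using assms(1,2,4)
proof (induction \<pi> arbitrary: R)
  case (Node Q ts)
  have Q: "R = sequent_of Q" "step \<C> (map (\<lambda>t. sequent_of (root_label t)) ts) R"
    using Node.prems(1) by (simp_all add: written_proof_Node)
  have mem: "A \<in> S" if "A \<in> set (fst Q) \<union> set (snd Q)" for A
  proof -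
    have "A \<in> set (formulas (Node Q ts))" using that set_subformulas_self[of A] by auto
    then show ?thesis using Node.prems(2) by blast
  qed
  then have S: "set (fst Q) \<subseteq> S" "set (snd Q) \<subseteq> S" by blast+
  have "sound (sequent_of (root_label t))" if "t \<in> set ts" for t
    using Node.prems that by (intro Node.IH[of t]) (auto simp: written_proof_Node closed_under_def)
  \<comment> \<open>The sequent at this node is itself one of the clauses: its antecedent is
    slashed, hence marked, hence so is its head.\<close>
  moreover have "set_mset (snd R) \<subseteq> M" if "\<forall>A \<in># fst R. slash A"
  proof -
    have "set (fst Q) \<subseteq> M" using that S(1) slash_mem by (auto simp: Q(1) sequent_of_def)
    moreover have "length (snd Q) \<le> 1"
      using step_single_conclusion[OF Q(2)] by (simp add: Q(1) sequent_of_def)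
    moreover have "set (body (mk_clause (Node Q ts))) \<subseteq> M \<longrightarrow> head (mk_clause (Node Q ts)) \<in> M"
      using Node.prems(3) by (simp add: closed_under_def)
    ultimately show ?thesis
      by (cases "snd Q") (auto simp: mk_clause_def Q(1) sequent_of_def Let_def)
  qed
  ultimately show ?case
    using Q S(2) by (intro step_sound[OF Q(2) _ ax]) (auto simp: sequent_of_def)
qed

end

section \<open>Correctness of the extraction\<close>

lemma provable_horn_rules:
  assumes "full \<Longrightarrow> provable (add_axioms CK \<C>) ({#}, {#Imp (Box p0) p0#})"
    "full \<Longrightarrow> provable (add_axioms CK \<C>) ({#}, {#Imp p0 (Dia p0)#})"
    and "(X, F) \<in> set (horn_rules full)"
  shows "provable (add_axioms CK \<C>) (mset X, {#F#})"
proof -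
  let ?P = "provable (add_axioms CK \<C>)"
  have id: "?P (add_mset A \<Gamma>, {#A#})" for A \<Gamma> by (rule provable_step[OF step.Id]) simp
  have mp: "?P ({#Imp A B, A#}, {#B#})" for A B
    by (rule provable_step[OF step.ImpL]) (auto intro: id)
  have imp: "?P ({#A#}, {#B#})" if "?P ({#}, {#Imp A B#})" for A B
  proof -
    have "?P ({#A#}, {#Imp A B#})"
      by (rule provable_step[OF step.WeakL[where \<Gamma> = "{#}"]]) (use that in auto)
    then show ?thesis by (intro provable_step[OF step.Cut[of _ _ "{#A#}" "Imp A B"]]) (auto intro: mp)
  qed
  have "?P ({#}, {#Top#})" by (rule provable_step[OF step.TopR]) simp
  moreover have "?P ({#Bot#}, {#p0#})" by (rule provable_step[OF step.BotL]) auto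
  moreover have "?P ({#p0, p1#}, {#And p0 p1#})"
    by (rule provable_step[OF step.AndR]) (use id[of p0 "{#p1#}"] id[of p1 "{#p0#}"] in \<open>simp add: add_mset_commute\<close>)
  moreover have "?P ({#And p0 p1#}, {#p0#})"
    by (rule provable_step[OF step.AndL1[where \<Gamma> = "{#}"]]) (auto intro: id)
  moreover have "?P ({#And p0 p1#}, {#p1#})"
    by (rule provable_step[OF step.AndL2[where \<Gamma> = "{#}"]]) (auto intro: id)
  moreover have "?P ({#p0#}, {#Or p0 p1#})"
    by (rule provable_step[OF step.OrR1]) (auto intro: id)
  moreover have "?P ({#p1#}, {#Or p0 p1#})"
    by (rule provable_step[OF step.OrR2]) (auto intro: id)
  moreover have "?P ({#Imp p0 p1, p0#}, {#p1#})" by (rule mp)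
  moreover have "?P ({#Box p0#}, {#p0#})" "?P ({#p0#}, {#Dia p0#})" if full
    using imp assms(1,2) that by blast+
  ultimately show ?thesis
    using assms(3) unfolding horn_rules_def by (cases full) auto
qed

lemma formulas_subformulas: "A \<in> set (formulas \<pi>) \<Longrightarrow> set (subformulas A) \<subseteq> set (formulas \<pi>)"
proof (induction \<pi>)
  case (Node R ts)
  consider B where "B \<in> set (fst R) \<union> set (snd R)" "A \<in> set (subformulas B)"
    | t where "t \<in> set ts" "A \<in> set (formulas t)"
    using Node.prems by auto
  then show ?case
  proof cases
    case 1
    then show ?thesis using subformulas_trans[OF 1(2)] by auto
  next
    case 2
    then show ?thesis using Node.IH[OF 2] by auto
  qed
qed

lemma find_proof_correct:
  assumes "justified (add_axioms CK \<C>) \<Sigma> s" "F \<in> set Fs" "F \<in> set (marked s \<Sigma>)"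
  shows "\<exists>F \<in> set Fs. wproves (add_axioms CK \<C>) \<Sigma> [F] (find_proof s \<Sigma> Fs \<pi>)"
proof (cases "dropWhile (\<lambda>F. F \<notin> set (marked s \<Sigma>)) Fs")
  case Nil
  then show ?thesis using assms(2,3) by (simp add: dropWhile_eq_Nil_conv)
next
  case (Cons G Gs)
  have "G \<in> set Fs" using Cons by (metis list.set_intros(1) set_dropWhileD)
  moreover have "G \<in> set (marked s \<Sigma>)"
    using Cons hd_dropWhile[of "\<lambda>F. F \<notin> set (marked s \<Sigma>)" Fs] by fastforce
  then have "wproves (add_axioms CK \<C>) \<Sigma> [G] (find_proof s \<Sigma> Fs \<pi>)"
    using cuts_proof[of \<C> \<Sigma> "rev s" "[]" G] assms(1) Cons by (simp add: find_proof_def)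
  ultimately show ?thesis by blast
qed

lemma is_harrop_iff: "is_harrop A \<longleftrightarrow> harrop A"
proof
  show "is_harrop A \<Longrightarrow> harrop A" by (induction A) (auto intro: harrop.intros)
  show "harrop A \<Longrightarrow> is_harrop A" by (induction rule: harrop.induct) simp_all
qed

lemma instances_mem:
  "t \<in> set T \<Longrightarrow> A \<in> set S \<Longrightarrow> B \<in> set S \<Longrightarrow>
    subst_wproof (pair_subst A B) t \<in> set (instances T S)"
  unfolding instances_def by auto

lemma certified_clauses:
  assumes T: "\<And>t. t \<in> set T \<Longrightarrow> written_proof (add_axioms CK \<C>) {} (sequent_of (root_label t)) t"
    and \<pi>: "written_proof (add_axioms CK \<C>) {} R \<pi>" and c: "c \<in> set (clauses T \<pi>)"
  shows "certified (add_axioms CK \<C>) c"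
proof -
  obtain t where t: "c = mk_clause t" "t \<in> set (subproofs \<pi>) \<union> set (instances T (formulas \<pi>))"
    using c by (auto simp: clauses_def)
  have "written_proof (add_axioms CK \<C>) {} (sequent_of (root_label t)) t"
  proof (cases "t \<in> set (subproofs \<pi>)")
    case True
    then show ?thesis by (rule written_proof_subproofs[OF \<pi>])
  next
    case False
    then obtain A B u where "u \<in> set T" "t = subst_wproof (pair_subst A B) u"
      using t(2) by (auto simp: instances_def)
    then show ?thesis using written_proof_subst T by blast
  qed
  then show ?thesis unfolding t(1) by (rule certified_mk_clause)
qed

text \<open>No splitting of \<open>\<Gamma>\<close> is mentioned: an implication that is not Harrop
  belongs to the implication side of every splitting, so the conclusion serves all of them.\<close>

lemma split_disjunction_correct:
  assumes T: "\<And>t. t \<in> set T \<Longrightarrow> written_proof (add_axioms CK \<C>) {} (sequent_of (root_label t)) t"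
    and H: "\<And>X F. (X, F) \<in> set (horn_rules full) \<Longrightarrow>
      \<exists>t \<in> set T. sequent_of (root_label t) = (mset X, {#F#})"
    and ax: "\<And>C V. C \<in> \<C> \<Longrightarrow> constructive C \<and> holds (node_frame full) V C"
    and \<pi>: "written_proof (add_axioms CK \<C>) {} (\<Gamma>, {#Or C D#}) \<pi>"
    and imp: "\<And>A. A \<in># \<Gamma> \<Longrightarrow> \<not> harrop A \<Longrightarrow> \<exists>B E. A = Imp B E"
  shows "\<exists>F. (F = C \<or> F = D \<or> (\<exists>B. Imp F B \<in># \<Gamma> \<and> \<not> harrop (Imp F B))) \<and>
    written_proof (add_axioms CK \<C>) {} (\<Gamma>, {#F#}) (split_disjunction T \<pi>)"
proof -
  obtain \<Sigma> \<Delta> where "root_label \<pi> = (\<Sigma>, \<Delta>)" by (cases "root_label \<pi>")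
  then have root: "root_label \<pi> = (\<Sigma>, [Or C D])" and \<Sigma>: "mset \<Sigma> = \<Gamma>"
    using written_proof_root[OF \<pi>] by (auto simp: sequent_of_def)
  define L where "L = clauses T \<pi>"
  define s where "s = saturate (concat (map (\<lambda>_. L) L)) \<Sigma>"
  define Fs where "Fs = C # D # concat (map antecedents \<Sigma>)"
  define M where "M = set (marked s \<Sigma>)"
  have f: "split_disjunction T \<pi> = find_proof s \<Sigma> Fs \<pi>"
    by (simp add: split_disjunction_def root s_def L_def Fs_def Let_def)
  have L: "certified (add_axioms CK \<C>) c" if "c \<in> set L" for c
    using that certified_clauses[of T, OF T \<pi>] unfolding L_def by blast
  have just: "justified (add_axioms CK \<C>) \<Sigma> s"
    unfolding s_def by (rule saturate_justified) (use L in \<open>auto split: if_splits\<close>)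
  have cl: "closed_under L M" unfolding M_def s_def by (rule saturate_closed)
  have \<Sigma>M: "set \<Sigma> \<subseteq> M" by (auto simp: M_def marked_def)
  let ?S = "set (formulas \<pi>)"
  have "set \<Sigma> \<subseteq> ?S" "Or C D \<in> ?S"
    using root set_subformulas_self by (cases \<pi>; fastforce)+
  then have "C \<in> ?S" "D \<in> ?S"
    using formulas_subformulas[of "Or C D" \<pi>] set_subformulas_self[of C] set_subformulas_self[of D]
    by auto
  have closed: "fm_subst (pair_subst A B) F \<in> M"
    if XF: "(X, F) \<in> set (horn_rules full)" and AB: "A \<in> ?S" "B \<in> ?S"
      and XM: "fm_subst (pair_subst A B) ` set X \<subseteq> M" for X F A B
  proof -
    obtain t where t: "t \<in> set T" "sequent_of (root_label t) = (mset X, {#F#})" using H[OF XF] by blast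
    then obtain X' where X': "root_label t = (X', [F])" "mset X' = mset X"
      by (cases "root_label t") (auto simp: sequent_of_def)
    let ?c = "mk_clause (subst_wproof (pair_subst A B) t)"
    have "?c \<in> set L" using instances_mem[OF t(1) AB] by (auto simp: L_def clauses_def)
    moreover have "body ?c = map (fm_subst (pair_subst A B)) X'" "head ?c = fm_subst (pair_subst A B) F"
      using X'(1) by (cases t; simp add: mk_clause_def subst_wproof_def)+
    moreover have "set X' = set X" using X'(2) by (rule mset_eq_setD)
    ultimately show ?thesis using cl XM unfolding closed_under_def by fastforce
  qed
  have "\<exists>F \<in> set Fs. F \<in> M"
  proof (rule ccontr)
    assume "\<not> ?thesis"
    then have no: "C \<notin> M" "D \<notin> M" "\<And>A F. A \<in> set \<Sigma> \<Longrightarrow> F \<in> set (antecedents A) \<Longrightarrow> F \<notin> M"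
      by (auto simp: Fs_def)
    \<comment> \<open>The ex falso rule, instantiated at \<open>C\<close>, would otherwise mark
      \<open>C\<close>.\<close>
    have "Bot \<notin> M"
      using closed[of "[Bot]" p0 C C] \<open>C \<in> ?S\<close> no(1) by (auto simp: horn_rules_def pair_subst_def)
    interpret saturated full M ?S
    proof
      show "?S \<noteq> {}" using \<open>C \<in> ?S\<close> by (metis empty_iff)
    qed (fact \<open>Bot \<notin> M\<close> | rule closed formulas_subformulas; assumption)+
    have "sound (\<Gamma>, {#Or C D#})"
    proof (rule written_proof_sound[OF \<pi> _ ax])
      show "closed_under (map mk_clause (subproofs \<pi>)) M"
        using cl by (auto simp: closed_under_def L_def clauses_def)
    qed auto
    moreover have "slash A" if "A \<in># \<Gamma>" for A
    proof (cases "harrop A")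
      case True
      have "A \<in> set \<Sigma>" using that \<Sigma> by auto
      then show ?thesis using \<Sigma>M \<open>set \<Sigma> \<subseteq> ?S\<close> by (intro slash_harrop[OF True]) auto
    next
      \<comment> \<open>The antecedent of such an implication is one of the candidates, so it is not
        marked and hence not slashed. The implication itself is marked and therefore slashed
        vacuously.\<close>
      case False
      then obtain B E where A: "A = Imp B E" using imp[OF \<open>A \<in># \<Gamma>\<close>] by blast
      have mem: "A \<in> set \<Sigma>" using that \<Sigma> by auto
      have "B \<notin> M" using no(3)[OF mem] False A is_harrop_iff by (simp add: antecedents_def)
      moreover have "B \<in> ?S" using S_simps(3)[of B E] mem A \<open>set \<Sigma> \<subseteq> ?S\<close> by blast
      ultimately have "\<not> slash B" using slash_mem by blast
      then show ?thesis using A mem \<Sigma>M by auto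
    qed
    ultimately have "slash C \<or> slash D" by (simp add: sound_def)
    then show False using slash_mem \<open>C \<in> ?S\<close> \<open>D \<in> ?S\<close> no(1,2) by blast
  qed
  then obtain F where "F \<in> set Fs" "F \<in> set (marked s \<Sigma>)" unfolding M_def by blast
  from find_proof_correct[OF just this, of \<pi>] obtain F where F: "F \<in> set Fs"
    "written_proof (add_axioms CK \<C>) {} (\<Gamma>, {#F#}) (split_disjunction T \<pi>)"
    unfolding f \<Sigma>[symmetric] by auto
  moreover have "\<exists>B. Imp F B \<in># \<Gamma> \<and> \<not> harrop (Imp F B)" if ne: "F \<noteq> C" "F \<noteq> D"
  proof -
    obtain A where A: "A \<in> set \<Sigma>" "F \<in> set (antecedents A)" using F(1) ne by (auto simp: Fs_def)
    then obtain B where "A = Imp F B" "\<not> harrop A"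
      by (cases A) (auto simp: antecedents_def is_harrop_iff split: if_splits)
    then show ?thesis using A(1) \<Sigma> by auto
  qed
  ultimately show ?thesis by blast
qed

text \<open>Under the identity substitution \<open>Atom\<close> the formula \<open>C\<close> is its
  own axiom instance, to which validity of the calculus applies.\<close>

lemma holds_axiom:
  assumes "valid_calculus K (add_axioms CK \<C>)" "C \<in> \<C>" shows "holds K V C"
proof -
  have "fm_subst Atom A = A" for A by (induction A) simp_all
  then have "provable (add_axioms CK \<C>) ({#}, {#C#})"
    using provable_step[OF step.Ax[OF assms(2), of Atom]] by simp
  then have "holds K V (Imp (big_and []) (big_or [C]))"
    using assms(1) unfolding valid_calculus_def valid_sequent_def
    by (metis fst_conv mset.simps mset_zero_iff_right snd_conv mset_single_iff_right)
  then show ?thesis by simp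
qed

theorem theorem4p22:
  fixes \<C> :: "fm set"
  assumes "finite \<C>"
    and "\<And>C. C \<in> \<C> \<Longrightarrow> constructive C"
    and "T_free (add_axioms CK \<C>) \<or> T_full (add_axioms CK \<C>)"
  shows "feasible_Visser_Harrop (add_axioms CK \<C>)"
proof -
  let ?G = "add_axioms CK \<C>"
  \<comment> \<open>One flag covers both cases: if the calculus is not \<open>T\<close>-full it is
    \<open>T\<close>-free, and either way it is valid in \<open>node_frame full\<close>.\<close>
  define full where "full \<longleftrightarrow> T_full ?G"
  have "valid_calculus (node_frame full) ?G"
    using assms(3) by (auto simp: full_def node_frame_def T_free_def T_full_def)
  then have ax: "constructive C \<and> holds (node_frame full) V C" if "C \<in> \<C>" for C V
    using assms(2) that holds_axiom by blast
  have "\<exists>t. written_proof ?G {} (mset X, {#F#}) t" if "(X, F) \<in> set (horn_rules full)" for X F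
    using provable_horn_rules[OF _ _ that, of \<C>] provable_written_proof
    by (auto simp: full_def T_full_def)
  then obtain w where w: "\<And>X F. (X, F) \<in> set (horn_rules full) \<Longrightarrow>
      written_proof ?G {} (mset X, {#F#}) (w X F)"
    by metis
  \<comment> \<open>\<open>T\<close> depends only on the calculus. It is fixed before any input is
    read, so choosing its members without an algorithm does not affect the running time.\<close>
  define T where "T = map (\<lambda>(X, F). w X F) (horn_rules full)"
  have T: "written_proof ?G {} (sequent_of (root_label t)) t" if "t \<in> set T" for t
    using that w written_proof_root by (fastforce simp: T_def)
  have H: "\<exists>t \<in> set T. sequent_of (root_label t) = (mset X, {#F#})"
    if "(X, F) \<in> set (horn_rules full)" for X F
    using that written_proof_root[OF w[OF that]] by (force simp: T_def)
  show ?thesis unfolding feasible_Visser_Harrop_def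
  proof (intro exI[of _ "split_disjunction T"] conjI allI impI poly_time_split_disjunction)
    fix \<pi> \<Gamma> and I :: "nat set" and A B C D \<Sigma>
    assume \<Gamma>: "\<forall>H \<in># \<Gamma>. harrop H" and I: "finite I"
      and \<Sigma>: "\<Sigma> = \<Gamma> + image_mset (\<lambda>i. Imp (A i) (B i)) (mset_set I)"
      and \<pi>: "written_proof ?G {} (\<Sigma>, {#Or C D#}) \<pi>"
    have "\<exists>B E. H = Imp B E" if "H \<in># \<Sigma>" "\<not> harrop H" for H
      using that \<Gamma> by (auto simp: \<Sigma>)
    then obtain F where F: "F = C \<or> F = D \<or> (\<exists>B. Imp F B \<in># \<Sigma> \<and> \<not> harrop (Imp F B))"
      "written_proof ?G {} (\<Sigma>, {#F#}) (split_disjunction T \<pi>)"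
      using split_disjunction_correct[OF T H ax \<pi>] by blast
    \<comment> \<open>An implication that is not Harrop cannot lie in \<open>\<Gamma>\<close>, so it
      is one of the \<open>Imp (A i) (B i)\<close>, and \<open>F\<close> is its antecedent.\<close>
    moreover have "F \<in> A ` I" if "Imp F B \<in># \<Sigma>" "\<not> harrop (Imp F B)" for B
      using that \<Gamma> I by (auto simp: \<Sigma>)
    ultimately show "written_proof ?G {} (\<Sigma>, {#C#}) (split_disjunction T \<pi>) \<or>
        written_proof ?G {} (\<Sigma>, {#D#}) (split_disjunction T \<pi>) \<or>
        (\<exists>i \<in> I. written_proof ?G {} (\<Sigma>, {#A i#}) (split_disjunction T \<pi>))"
      by blast
  qed
qed

end
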